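(* Let $X$ be a complex Banach space, $T\in\mathcal{B}(X)$, and let $R\in\mathcal{B}(X)$ be a Riesz operator which commutes with $T$. Then the following statements hold: (1) If $iso(\sigma_e(T))=\emptyset$, then $\sigma_{pBF}(T+R)=\sigma_{pBF}(T)$; (2) If $iso(\sigma_W(T))=\emptyset$, then $\sigma_{gD\mathcal{W}}(T+R)=\sigma_{gD\mathcal{W}}(T)$.
   Context: $\mathcal{B}(X)$ is the algebra of bounded linear operators on $X$. An operator $R$ is Riesz if $R-\mu I$ is Fredholm for every nonzero $\mu\in\mathbb{C}$. $iso(A)$ denotes the set of isolated points of $A\subseteq\mathbb{C}$. A Weyl operator is a Fredholm operator of index zero. $\sigma_e(T)$ and $\sigma_W(T)$ are the sets of $\lambda\in\mathbb{C}$ such that $T-\lambda I$ is not Fredholm, respectively not Weyl. $T$ is pseudo B-Fredholm (resp. pseudo B-Weyl) if there are closed $T$-invariant subspaces $X_1,X_2$ with $X=X_1\oplus X_2$ such that $T_{|X_1}$ is Fredholm (resp. Weyl) and $T_{|X_2}$ is quasi-nilpotent. $\sigma_{pBF}(T)$ (resp. $\sigma_{gD\mathcal{W}}(T)$) is the set of $\lambda\in\mathbb{C}$ such that $T-\lambda I$ is not pseudo B-Fredholm (resp. not pseudo B-Weyl). *)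

theory Defs
  imports "HOL-Complex_Analysis.Complex_Analysis"
begin

section \<open>Complex Banach spaces\<close>

text \<open>Complex scalars are added on top of the real class \<^class>\<open>banach\<close>; the axiom
  \<open>scaleR_scaleC\<close> makes the given real structure the restriction of scalars.\<close>

class complex_banach = banach +
  fixes scaleC :: "complex \<Rightarrow> 'a \<Rightarrow> 'a"  (infixr \<open>*\<^sub>C\<close> 75)
  assumes scaleC_add_right: "a *\<^sub>C (x + y) = a *\<^sub>C x + a *\<^sub>C y"
    and scaleC_add_left: "(a + b) *\<^sub>C x = a *\<^sub>C x + b *\<^sub>C x"
    and scaleC_scaleC: "a *\<^sub>C b *\<^sub>C x = (a * b) *\<^sub>C x"
    and scaleC_one: "1 *\<^sub>C x = x"
    and scaleR_scaleC: "r *\<^sub>R x = complex_of_real r *\<^sub>C x"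
    and norm_scaleC: "norm (a *\<^sub>C x) = cmod a * norm x"

global_interpretation complex_vector: vector_space "scaleC :: complex \<Rightarrow> 'a \<Rightarrow> 'a::complex_banach"
  defines csubspace = complex_vector.subspace
    and cspan = complex_vector.span
    and cdependent = complex_vector.dependent
    and crepresentation = complex_vector.representation
    and cextend_basis = complex_vector.extend_basis
    and cdim = complex_vector.dim
  by unfold_locales (simp_all add: scaleC_add_right scaleC_add_left scaleC_scaleC scaleC_one)

definition bounded_clinear :: "('a::complex_banach \<Rightarrow> 'a) \<Rightarrow> bool"
  where "bounded_clinear T \<longleftrightarrow> bounded_linear T \<and> (\<forall>c x. T (c *\<^sub>C x) = c *\<^sub>C T x)"

abbreviation shift_op :: "('a::complex_banach \<Rightarrow> 'a) \<Rightarrow> complex \<Rightarrow> 'a \<Rightarrow> 'a"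
  where "shift_op T \<mu> \<equiv> (\<lambda>x. T x - \<mu> *\<^sub>C x)"


section \<open>Dimension, direct sums and codimension\<close>

text \<open>\<^const>\<open>cdim\<close> is \<open>0\<close> on infinite-dimensional subspaces, so finiteness is always
  stated separately.\<close>

definition finite_cdim :: "'a::complex_banach set \<Rightarrow> bool"
  where "finite_cdim S \<longleftrightarrow> (\<exists>B. finite B \<and> cspan B = S)"

definition direct_sum :: "'a::complex_banach set \<Rightarrow> 'a set \<Rightarrow> 'a set \<Rightarrow> bool"
  where "direct_sum V W C \<longleftrightarrow>
    csubspace W \<and> csubspace C \<and> W \<inter> C = {0} \<and> V = {w + c |w c. w \<in> W \<and> c \<in> C}"

text \<open>\<open>dim (V / W)\<close>, as the dimension of an algebraic complement of \<open>W\<close> in \<open>V\<close>.  All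
  complements are isomorphic to \<open>V / W\<close>, so the description is unique when one of them
  is finite-dimensional; otherwise the value of \<open>ccodim\<close> is meaningless.\<close>

definition finite_ccodim :: "'a::complex_banach set \<Rightarrow> 'a set \<Rightarrow> bool"
  where "finite_ccodim V W \<longleftrightarrow> (\<exists>C. direct_sum V W C \<and> finite_cdim C)"

definition ccodim :: "'a::complex_banach set \<Rightarrow> 'a set \<Rightarrow> nat"
  where "ccodim V W = (THE n. \<exists>C. direct_sum V W C \<and> finite_cdim C \<and> cdim C = n)"


section \<open>Fredholm, Weyl, Riesz and quasi-nilpotent operators\<close>

text \<open>The predicates with suffix \<open>_on\<close> concern the restriction of \<open>T\<close> to a closed
  \<open>T\<close>-invariant subspace \<open>M\<close>, viewed as an operator from \<open>M\<close> to \<open>M\<close>.  Closedness of the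
  range is not required in \<open>fredholm_on\<close>: for bounded operators on a Banach space it
  follows from finite codimension.\<close>

definition ker_on :: "'a::complex_banach set \<Rightarrow> ('a \<Rightarrow> 'a) \<Rightarrow> 'a set"
  where "ker_on M T = {x \<in> M. T x = 0}"

definition fredholm_on :: "'a::complex_banach set \<Rightarrow> ('a \<Rightarrow> 'a) \<Rightarrow> bool"
  where "fredholm_on M T \<longleftrightarrow> finite_cdim (ker_on M T) \<and> finite_ccodim M (T ` M)"

definition fredholm_index_on :: "'a::complex_banach set \<Rightarrow> ('a \<Rightarrow> 'a) \<Rightarrow> int"
  where "fredholm_index_on M T = int (cdim (ker_on M T)) - int (ccodim M (T ` M))"

definition weyl_on :: "'a::complex_banach set \<Rightarrow> ('a \<Rightarrow> 'a) \<Rightarrow> bool"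
  where "weyl_on M T \<longleftrightarrow> fredholm_on M T \<and> fredholm_index_on M T = 0"

abbreviation fredholm :: "('a::complex_banach \<Rightarrow> 'a) \<Rightarrow> bool"
  where "fredholm \<equiv> fredholm_on UNIV"

abbreviation weyl :: "('a::complex_banach \<Rightarrow> 'a) \<Rightarrow> bool"
  where "weyl \<equiv> weyl_on UNIV"

definition riesz :: "('a::complex_banach \<Rightarrow> 'a) \<Rightarrow> bool"
  where "riesz R \<longleftrightarrow> bounded_clinear R \<and> (\<forall>\<mu>. \<mu> \<noteq> 0 \<longrightarrow> fredholm (shift_op R \<mu>))"

text \<open>Invertibility in the algebra of bounded operators on \<open>M\<close>; linearity of a two-sided
  inverse is automatic.\<close>

definition invertible_on :: "'a::complex_banach set \<Rightarrow> ('a \<Rightarrow> 'a) \<Rightarrow> bool"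
  where "invertible_on M T \<longleftrightarrow>
    (\<exists>S. (\<forall>x\<in>M. S x \<in> M \<and> S (T x) = x \<and> T (S x) = x) \<and>
         (\<exists>K. \<forall>x\<in>M. norm (S x) \<le> K * norm x))"

definition spectrum_on :: "'a::complex_banach set \<Rightarrow> ('a \<Rightarrow> 'a) \<Rightarrow> complex set"
  where "spectrum_on M T = {\<mu>. \<not> invertible_on M (shift_op T \<mu>)}"

text \<open>Inclusion rather than equality: on \<open>M = {0}\<close> the spectrum is empty, and the zero
  operator there is quasi-nilpotent.\<close>

definition quasinilpotent_on :: "'a::complex_banach set \<Rightarrow> ('a \<Rightarrow> 'a) \<Rightarrow> bool"
  where "quasinilpotent_on M T \<longleftrightarrow> spectrum_on M T \<subseteq> {0}"


section \<open>Pseudo B-Fredholm and pseudo B-Weyl operators, and the spectra\<close>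

definition closed_invariant :: "('a::complex_banach \<Rightarrow> 'a) \<Rightarrow> 'a set \<Rightarrow> bool"
  where "closed_invariant T M \<longleftrightarrow> csubspace M \<and> closed M \<and> T ` M \<subseteq> M"

definition pseudo_b_fredholm :: "('a::complex_banach \<Rightarrow> 'a) \<Rightarrow> bool"
  where "pseudo_b_fredholm T \<longleftrightarrow>
    (\<exists>X1 X2. closed_invariant T X1 \<and> closed_invariant T X2 \<and> direct_sum UNIV X1 X2 \<and>
       fredholm_on X1 T \<and> quasinilpotent_on X2 T)"

definition pseudo_b_weyl :: "('a::complex_banach \<Rightarrow> 'a) \<Rightarrow> bool"
  where "pseudo_b_weyl T \<longleftrightarrow>
    (\<exists>X1 X2. closed_invariant T X1 \<and> closed_invariant T X2 \<and> direct_sum UNIV X1 X2 \<and>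
       weyl_on X1 T \<and> quasinilpotent_on X2 T)"

definition essential_spectrum :: "('a::complex_banach \<Rightarrow> 'a) \<Rightarrow> complex set"
  where "essential_spectrum T = {\<mu>. \<not> fredholm (shift_op T \<mu>)}"

definition weyl_spectrum :: "('a::complex_banach \<Rightarrow> 'a) \<Rightarrow> complex set"
  where "weyl_spectrum T = {\<mu>. \<not> weyl (shift_op T \<mu>)}"

definition pseudo_b_fredholm_spectrum :: "('a::complex_banach \<Rightarrow> 'a) \<Rightarrow> complex set"
  where "pseudo_b_fredholm_spectrum T = {\<mu>. \<not> pseudo_b_fredholm (shift_op T \<mu>)}"

definition pseudo_b_weyl_spectrum :: "('a::complex_banach \<Rightarrow> 'a) \<Rightarrow> complex set"
  where "pseudo_b_weyl_spectrum T = {\<mu>. \<not> pseudo_b_weyl (shift_op T \<mu>)}"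

end

theory Submission
  imports Defs
begin

text \<open>
  The theorem reduces to two facts about the essential and the Weyl spectrum.

  First, these two spectra are stable: a Riesz operator commuting with \<open>T\<close> changes neither
  of them (\<open>commuting_riesz_perturbation\<close>).  Secondly, if \<open>T - \<lambda>\<close> is pseudo B-Fredholm, then
  \<open>T - \<lambda> - \<mu>\<close> is Fredholm for all small \<open>\<mu> \<noteq> 0\<close> (\<open>punctured_neighbourhood\<close>): the
  Fredholm summand stays Fredholm and the quasi-nilpotent summand becomes invertible.  So a
  point of the essential spectrum at which \<open>T - \<lambda>\<close> is pseudo B-Fredholm is isolated in it, and
  without isolated points the pseudo B-Fredholm spectrum and the essential spectrum coincide
  (\<open>pseudo_b_spectra_without_isolated_points\<close>).  By stability, \<open>T + R\<close> has the same essential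
  spectrum, hence also no isolated points in it, and the same reasoning applies to \<open>T + R\<close>.
  The argument for Weyl operators is the same.

  Stability is an algebraic statement in the quotient of the bounded operators by the
  finite-rank operators, with the seminorm induced by the operator norm.  Fredholm operators are
  those with invertible class (\<open>fredholm_iff_invertible\<close>), and Weyl operators are those whose
  class contains a bijective operator (\<open>weyl_iff_weyl_class\<close>); the latter classes form a
  subgroup \<open>W\<close> of the group of units which contains the open unit ball around \<open>1\<close>.  The class
  \<open>r\<close> of a Riesz operator has the property that \<open>1 - z r\<close> is invertible for all complex \<open>z\<close>, and
  this forces \<open>r\<close> to have spectral radius \<open>0\<close> in the weak form that for every \<open>c\<close> some power
  satisfies \<open>p (r ^ n) * c ^ n < 1\<close> (\<open>quasinilpotent_growth\<close>).  If \<open>u\<close> is a unit commuting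
  with \<open>r\<close>, then a high power of \<open>t u\<^sup>-\<^sup>1 r\<close> is small, so \<open>u + t r\<close> is a unit for every \<open>t\<close>; and
  since \<open>W\<close> is open, membership in \<open>W\<close> is locally constant along the segment from \<open>u\<close> to
  \<open>u + r\<close> (\<open>quasinilpotent_perturbation\<close>).  This takes the place of the homotopy invariance of
  the index.

  Two classical theorems are needed to pass between operators and their classes: the open
  mapping theorem, for the boundedness of inverses and projections, and the Hahn-Banach theorem,
  for projections onto finite-dimensional subspaces.
\<close>

section \<open>The open mapping theorem\<close>

text \<open>By Baire's theorem, one of the closures of the images of the balls \<open>cball 0 n\<close> has interior.
Subtracting the centre of a ball inside it yields approximate solutions of \<open>f x = y\<close> for all
small \<open>y\<close>, and scaling transfers this to every \<open>y\<close>.\<close>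
lemma open_mapping_approx:
  fixes f :: "'a::banach \<Rightarrow> 'b::banach"
  assumes f: "bounded_linear f" and S: "subspace S" and onto: "f ` S = UNIV"
  obtains K where "K \<ge> 0" "\<And>y. \<exists>x\<in>S. norm x \<le> K * norm y \<and> norm (y - f x) \<le> norm y / 2"
proof -
  interpret f: bounded_linear f by fact
  define C where "C n = closure (f ` (S \<inter> cball 0 (real n)))" for n :: nat
  have "\<exists>n. interior (C n) \<noteq> {}"
  proof (rule ccontr)
    assume "\<not> ?thesis"
    then have "euclidean interior_of (\<Union>(range C)) = {}"
      by (intro Baire_category_alt) (auto simp: completely_metrizable_space_euclidean C_def)
    moreover have "\<Union>(range C) = UNIV"
    proof -
      have "y \<in> \<Union>(range C)" for y
      proof -
        obtain x where "x \<in> S" "y = f x" using onto by (metis UNIV_I imageE)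
        moreover obtain n where "norm x \<le> real n" using real_arch_simple by blast
        ultimately have "y \<in> C n"
          unfolding C_def by (intro subsetD[OF closure_subset]) auto
        then show ?thesis by blast
      qed
      then show ?thesis by blast
    qed
    ultimately show False by simp
  qed
  then obtain n y0 r where r: "r > 0" "ball y0 r \<subseteq> C n"
    by (metis ex_in_conv mem_interior)
  \<comment> \<open>Vectors are scaled to norm \<open>r / 2\<close>, where differences of points of the ball give solutions of
      norm at most \<open>2 n\<close>.\<close>
  define K where "K = 2 * real n / (r / 2)"
  have small: "\<exists>x\<in>S. norm x \<le> 2 * real n \<and> norm (y - f x) \<le> e"
    if y: "norm y < r" and e: "e > 0" for y e
  proof -
    have "y0 + y \<in> C n" "y0 \<in> C n"
      using r y by (auto simp: subset_iff dist_norm)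
    then obtain a b where ab: "a \<in> S" "norm a \<le> n" "norm (f a - (y0 + y)) < e/2"
        "b \<in> S" "norm b \<le> n" "norm (f b - y0) < e/2"
    proof -
      have *: "\<exists>a\<in>S. norm a \<le> n \<and> norm (f a - w) < e/2" if "w \<in> C n" for w
      proof -
        have "\<exists>u\<in>f ` (S \<inter> cball 0 (real n)). dist u w < e/2"
          using that half_gt_zero[OF e] unfolding C_def closure_approachable by blast
        then show ?thesis by (auto simp: dist_norm)
      qed
      then show ?thesis
        using that \<open>y0 + y \<in> C n\<close> \<open>y0 \<in> C n\<close> by meson
    qed
    have eq: "y - f (a - b) = (f b - y0) - (f a - (y0 + y))"
      by (simp add: f.diff)
    have "norm (y - f (a - b)) \<le> e"
      unfolding eq using ab(3,6) norm_triangle_ineq4[of "f b - y0" "f a - (y0+y)"] by linarith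
    moreover have "norm (a - b) \<le> 2 * real n"
      using ab(2,5) norm_triangle_ineq4[of a b] by linarith
    moreover have "a - b \<in> S" using S ab(1,4) by (rule subspace_diff)
    ultimately show ?thesis by blast
  qed
  have "\<exists>x\<in>S. norm x \<le> K * norm y \<and> norm (y - f x) \<le> norm y / 2" for y
  proof (cases "y = 0")
    case True
    then show ?thesis using S by (intro bexI[of _ 0]) (auto simp: subspace_0 f.zero)
  next
    case False
    define c where "c = (r / 2) / norm y"
    have c: "c > 0" using False r by (simp add: c_def)
    have "norm (c *\<^sub>R y) < r" using False r by (simp add: c_def)
    from small[OF this, of "c * norm y / 2"] obtain x where
      x: "x \<in> S" "norm x \<le> 2 * real n" "norm (c *\<^sub>R y - f x) \<le> c * norm y / 2"
      using c False by auto
    have eq: "y - f (x /\<^sub>R c) = (c *\<^sub>R y - f x) /\<^sub>R c"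
      using c by (simp add: f.scaleR scaleR_diff_right)
    have "norm (y - f (x /\<^sub>R c)) \<le> norm y / 2"
      unfolding eq norm_scaleR using x(3) c by (simp add: field_simps)
    moreover have "norm (x /\<^sub>R c) \<le> K * norm y"
      using x(2) c False r by (simp add: K_def c_def field_simps)
    moreover have "x /\<^sub>R c \<in> S" using S x(1) by (rule subspace_scale)
    ultimately show ?thesis by blast
  qed
  moreover have "K \<ge> 0" using r by (simp add: K_def)
  ultimately show ?thesis using that by blast
qed

text \<open>Iterating the approximate solutions halves the residual each time, so the corrections form an
absolutely convergent series.  The domain is a closed subspace rather than a whole type because
the theorem is applied to product sets such as the pairs of vectors from two closed subspaces.\<close>
lemma open_mapping:
  fixes f :: "'a::banach \<Rightarrow> 'b::banach"
  assumes f: "bounded_linear f" and S: "subspace S" "closed S" and onto: "f ` S = UNIV"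
  obtains K where "\<And>y. \<exists>x\<in>S. f x = y \<and> norm x \<le> K * norm y"
proof -
  interpret f: bounded_linear f by fact
  obtain K where K: "K \<ge> 0"
      "\<And>y. \<exists>x\<in>S. norm x \<le> K * norm y \<and> norm (y - f x) \<le> norm y / 2"
    using open_mapping_approx[OF f S(1) onto] by blast
  then obtain g where g: "\<And>y. g y \<in> S" "\<And>y. norm (g y) \<le> K * norm y"
      "\<And>y. norm (y - f (g y)) \<le> norm y / 2"
    by metis
  have "\<exists>x\<in>S. f x = y \<and> norm x \<le> 2 * K * norm y" for y
  proof -
    \<comment> \<open>The residual after \<open>k\<close> corrections.\<close>
    define z where "z k = ((\<lambda>u. u - f (g u)) ^^ k) y" for k
    have z0: "z 0 = y" and zS: "z (Suc k) = z k - f (g (z k))" for k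
      by (simp_all add: z_def)
    have nz: "norm (z k) \<le> norm y * (1/2)^k" for k
    proof (induction k)
      case (Suc k)
      show ?case using g(3)[of "z k"] Suc by (simp add: zS)
    qed (simp add: z0)
    have bd: "norm (g (z k)) \<le> K * norm y * (1/2)^k" for k
      using g(2)[of "z k"] mult_left_mono[OF nz[of k] K(1)] by (simp add: mult.assoc)
    have geo: "(\<lambda>k. K * norm y * (1/2::real)^k) sums (K * norm y * 2)"
      using geometric_sums[of "1/2::real"] by (intro sums_mult) simp
    have sm: "summable (\<lambda>k. norm (g (z k)))"
      by (rule summable_comparison_test'[OF sums_summable[OF geo], of 0]) (use bd in auto)
    define x where "x = (\<Sum>k. g (z k))"
    have sx: "(\<lambda>k. g (z k)) sums x"
      unfolding x_def using summable_norm_cancel[OF sm] by (rule summable_sums)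
    have "x \<in> S"
    proof (rule closed_sequentially[OF S(2)])
      show "(\<Sum>k<n. g (z k)) \<in> S" for n using S(1) g(1) by (intro subspace_sum) auto
      show "(\<lambda>n. \<Sum>k<n. g (z k)) \<longlonglongrightarrow> x" using sx by (simp add: sums_def)
    qed
    moreover have "f x = y"
    proof -
      have part: "(\<Sum>k<n. f (g (z k))) = y - z n" for n
        by (induction n) (auto simp: z0 zS)
      have "(\<lambda>n. norm y * (1/2)^n) \<longlonglongrightarrow> 0"
        by (intro tendsto_mult_right_zero LIMSEQ_realpow_zero) auto
      then have "z \<longlonglongrightarrow> 0"
        by (rule Lim_null_comparison[rotated]) (use nz in auto)
      then have "(\<lambda>n. y - z n) \<longlonglongrightarrow> y - 0" by (intro tendsto_intros)
      then have "(\<lambda>k. f (g (z k))) sums y" by (simp add: sums_def part)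
      moreover have "(\<lambda>k. f (g (z k))) sums f x" by (rule f.sums[OF sx])
      ultimately show ?thesis by (rule sums_unique2[symmetric])
    qed
    moreover have "norm x \<le> 2 * K * norm y"
    proof -
      have "norm x \<le> (\<Sum>k. norm (g (z k)))" unfolding x_def by (rule summable_norm[OF sm])
      also have "\<dots> \<le> K * norm y * 2"
        using suminf_le[OF bd sm sums_summable[OF geo]] sums_unique[OF geo] by simp
      finally show ?thesis by simp
    qed
    ultimately show ?thesis by blast
  qed
  then show ?thesis using that by blast
qed

section \<open>The Hahn-Banach theorem\<close>

definition sublinear :: "('a::real_vector \<Rightarrow> real) \<Rightarrow> bool" where
  "sublinear q \<longleftrightarrow> (\<forall>x y. q (x + y) \<le> q x + q y) \<and> (\<forall>t x. t \<ge> 0 \<longrightarrow> q (t *\<^sub>R x) = t * q x)"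

lemma sublinear_zero:
  assumes "sublinear q" shows "q 0 = 0"
  using assms unfolding sublinear_def by (metis mult_zero_left order_refl scaleR_zero_left)

lemma sublinear_lower:
  assumes "sublinear q" shows "- q (- x) \<le> q x"
proof -
  have "q 0 = 0" using assms by (rule sublinear_zero)
  moreover have "q (x + - x) \<le> q x + q (- x)" using assms unfolding sublinear_def by blast
  ultimately show ?thesis by simp
qed

text \<open>Zorn's lemma: the pointwise infimum of a chain of sublinear functionals below \<open>p\<close> is again
sublinear, and it is finite because every member is at least \<open>- p (- x)\<close> at \<open>x\<close>.\<close>
lemma sublinear_minimal:
  assumes p: "sublinear p"
  obtains q where "sublinear q" "\<And>x. q x \<le> p x"
    "\<And>q'. sublinear q' \<Longrightarrow> (\<And>x. q' x \<le> q x) \<Longrightarrow> q' = q"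
proof -
  define A where "A = {q. sublinear q \<and> (\<forall>x. q x \<le> p x)}"
  define P where "P = (\<lambda>q q' :: 'a \<Rightarrow> real. \<forall>x. q' x \<le> q x)"
  have "\<exists>m\<in>A. \<forall>a\<in>A. P m a \<longrightarrow> a = m"
  proof (rule predicate_Zorn)
    show "partial_order_on A (relation_of P A)"
    proof (rule partial_order_on_relation_ofI)
      show "P a c" if "P a b" "P b c" for a b c
        using that unfolding P_def by (meson order_trans)
      show "a = b" if "P a b" "P b a" for a b
        using that unfolding P_def by (intro ext antisym) auto
    qed (simp add: P_def)
  next
    fix C assume C: "C \<in> Chains (relation_of P A)"
    then have CA: "C \<subseteq> A" and tot: "\<And>q q'. q \<in> C \<Longrightarrow> q' \<in> C \<Longrightarrow> P q q' \<or> P q' q"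
      by (auto simp: Chains_def relation_of_def)
    show "\<exists>u\<in>A. \<forall>a\<in>C. P a u"
    proof (cases "C = {}")
      case True
      then show ?thesis using p by (auto simp: A_def)
    next
      case False
      define u where "u x = (INF q\<in>C. q x)" for x
      have lb: "- p (- x) \<le> q x" if "q \<in> C" for q x
        proof -
        have "sublinear q" "q (- x) \<le> p (- x)" using that CA by (auto simp: A_def)
        then show ?thesis using sublinear_lower[of q x] by simp
      qed
      have bdd: "bdd_below ((\<lambda>q. q x) ` C)" for x
        using lb by (auto intro!: bdd_belowI)
      have ule: "u x \<le> q x" if "q \<in> C" for q x
        unfolding u_def by (rule cINF_lower[OF bdd that])
      have glb: "c \<le> u x" if "\<And>q. q \<in> C \<Longrightarrow> c \<le> q x" for c x
        unfolding u_def by (rule cINF_greatest[OF False that])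
      have add: "u (x + y) \<le> u x + u y" for x y
      proof -
        have "u (x + y) \<le> q1 x + q2 y" if h: "q1 \<in> C" "q2 \<in> C" for q1 q2
        proof -
          obtain q where q: "q \<in> C" "q x \<le> q1 x" "q y \<le> q2 y"
            using tot[OF h] h unfolding P_def by blast
          have "u (x + y) \<le> q (x + y)" by (rule ule[OF q(1)])
          also have "\<dots> \<le> q x + q y" using q(1) CA by (auto simp: A_def sublinear_def)
          finally show ?thesis using q by linarith
        qed
        then have "u (x + y) - q2 y \<le> u x" if "q2 \<in> C" for q2
          using that by (intro glb) (simp add: algebra_simps)
        then have "u (x + y) - u x \<le> u y"
          by (intro glb) (simp add: algebra_simps)
        then show ?thesis by simp
      qed
      have hom: "u (t *\<^sub>R x) = t * u x" if "t \<ge> 0" for t x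
      proof (cases "t = 0")
        case True
        have "q 0 = 0" if "q \<in> C" for q
          using that CA sublinear_zero by (auto simp: A_def)
        then have "(\<lambda>q. q 0) ` C = {0}" using \<open>C \<noteq> {}\<close> by force
        then show ?thesis using True by (simp add: u_def)
      next
        case False
        then have t: "t > 0" using that by simp
        have q: "q (t *\<^sub>R x) = t * q x" if "q \<in> C" for q
          using that CA t by (auto simp: A_def sublinear_def)
        have "u (t *\<^sub>R x) / t \<le> u x"
          using ule[of _ "t *\<^sub>R x"] q t by (intro glb) (simp add: field_simps)
        moreover have "t * u x \<le> u (t *\<^sub>R x)"
        proof (rule glb)
          fix q assume "q \<in> C"
          then show "t * u x \<le> q (t *\<^sub>R x)"
            using mult_left_mono[OF ule[of q x], of t] q[of q] t by simp
        qed
        ultimately show ?thesis using t by (simp add: field_simps)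
      qed
      have "u \<in> A"
        using add hom ule CA False unfolding A_def sublinear_def
        by (auto simp: subset_iff) (meson ex_in_conv order_trans)
      then show ?thesis using ule by (auto simp: P_def)
    qed
  qed
  then obtain q where q: "q \<in> A" "\<And>a. a \<in> A \<Longrightarrow> P q a \<Longrightarrow> a = q" by blast
  show ?thesis
  proof (rule that)
    show "sublinear q" "q x \<le> p x" for x using q(1) by (auto simp: A_def)
    show "q' = q" if "sublinear q'" "\<And>x. q' x \<le> q x" for q'
      using that q(1) by (intro q(2)) (auto simp: A_def P_def intro: order_trans)
  qed
qed

text \<open>The functional \<open>q' x = inf {q (x + t a) - t q a | t \<ge> 0}\<close> makes \<open>q\<close> additive in the direction
\<open>a\<close>.  A minimal \<open>q\<close> must coincide with its \<open>q'\<close> for every \<open>a\<close>, hence is linear.\<close>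
lemma sublinear_slope:
  assumes q: "sublinear q"
  obtains q' where "sublinear q'" "\<And>x. q' x \<le> q x" "\<And>x. q' x \<le> q (x + a) - q a"
proof -
  define I where "I x = (\<lambda>t. q (x + t *\<^sub>R a) - t * q a) ` {0..}" for x
  define q' where "q' x = Inf (I x)" for x
  have sub: "q (x + y) \<le> q x + q y" and hom: "t \<ge> 0 \<Longrightarrow> q (t *\<^sub>R x) = t * q x" for t x y
    using q by (auto simp: sublinear_def)
  have lb: "- q (- x) \<le> q (x + t *\<^sub>R a) - t * q a" if "t \<ge> 0" for x t
    using sub[of "x + t *\<^sub>R a" "- x"] hom[OF that, of a] by simp
  have bdd: "bdd_below (I x)" for x
    unfolding I_def using lb by (auto intro!: bdd_belowI)
  have le: "q' x \<le> q (x + t *\<^sub>R a) - t * q a" if "t \<ge> 0" for x t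
    unfolding q'_def using that by (intro cInf_lower bdd) (auto simp: I_def)
  have glb: "c \<le> q' x" if "\<And>t. t \<ge> 0 \<Longrightarrow> c \<le> q (x + t *\<^sub>R a) - t * q a" for c x
    unfolding q'_def using that by (intro cInf_greatest) (auto simp: I_def)
  have add: "q' (x + y) \<le> q' x + q' y" for x y
  proof -
    have "q' (x + y) \<le> (q (x + s *\<^sub>R a) - s * q a) + (q (y + t *\<^sub>R a) - t * q a)"
      if "s \<ge> 0" "t \<ge> 0" for s t
      using le[of "s + t" "x + y"] sub[of "x + s *\<^sub>R a" "y + t *\<^sub>R a"] that
      by (simp add: algebra_simps)
    then have "q' (x + y) - (q (y + t *\<^sub>R a) - t * q a) \<le> q' x" if "t \<ge> 0" for t
      using that by (intro glb) (simp add: algebra_simps)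
    then have "q' (x + y) - q' x \<le> q' y"
      by (intro glb) (smt (verit))
    then show ?thesis by simp
  qed
  have le1: "r * q' x \<le> q' (r *\<^sub>R x)" if r: "r > 0" for r x
  proof (rule glb)
    fix t :: real assume t: "t \<ge> 0"
    have "r * q' x \<le> r * (q (x + (t / r) *\<^sub>R a) - (t / r) * q a)"
      using le[of "t / r" x] r t by simp
    also have "\<dots> = q (r *\<^sub>R (x + (t / r) *\<^sub>R a)) - t * q a"
      using hom[of r "x + (t / r) *\<^sub>R a"] r by (simp add: algebra_simps)
    also have "r *\<^sub>R (x + (t / r) *\<^sub>R a) = r *\<^sub>R x + t *\<^sub>R a"
      using r by (simp add: algebra_simps)
    finally show "r * q' x \<le> q (r *\<^sub>R x + t *\<^sub>R a) - t * q a" .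
  qed
  have "q' 0 = 0"
  proof (rule antisym)
    show "q' 0 \<le> 0" using le[of 0 0] hom[of 0 0] by simp
    show "0 \<le> q' 0" by (rule glb) (simp add: hom)
  qed
  have hom': "q' (r *\<^sub>R x) = r * q' x" if r: "r \<ge> 0" for r x
  proof (cases "r = 0")
    case False
    then have r: "r > 0" using r by simp
    have "q' (r *\<^sub>R x) \<le> r * q' x"
      using le1[of "1 / r" "r *\<^sub>R x"] r by (simp add: field_simps)
    then show ?thesis using le1[OF r, of x] by simp
  qed (simp add: \<open>q' 0 = 0\<close>)
  show ?thesis
    by (rule that[of q']) (use add hom' le[of 0] le[of 1] in \<open>auto simp: sublinear_def\<close>)
qed

text \<open>The construction above is used twice: once at \<open>a\<close>, to force the value \<open>p a\<close> there, and then at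
every vector, to see that a minimal functional is superadditive and hence linear.\<close>
lemma hahn_banach_sublinear:
  assumes p: "sublinear p"
  obtains u where "linear u" "\<And>x. u x \<le> p x" "u a = (p a :: real)"
proof -
  obtain p' where p': "sublinear p'" "\<And>x. p' x \<le> p x" "\<And>x. p' x \<le> p (x + a) - p a"
    using sublinear_slope[OF p] by blast
  obtain u where u: "sublinear u" "\<And>x. u x \<le> p' x"
      and min: "\<And>q. sublinear q \<Longrightarrow> (\<And>x. q x \<le> u x) \<Longrightarrow> q = u"
    using sublinear_minimal[OF p'(1)] by blast
  have sub: "u (x + y) \<le> u x + u y" and hom: "t \<ge> 0 \<Longrightarrow> u (t *\<^sub>R x) = t * u x" for t x y
    using u(1) by (auto simp: sublinear_def)
  have super: "u x + u b \<le> u (x + b)" for x b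
  proof -
    obtain q where "sublinear q" "\<And>x. q x \<le> u x" "\<And>x. q x \<le> u (x + b) - u b"
      using sublinear_slope[OF u(1)] by blast
    then show ?thesis using min by (metis le_diff_eq)
  qed
  have add: "u (x + y) = u x + u y" for x y
    using sub super by (intro antisym) auto
  have u0: "u 0 = 0" using hom[of 0 0] by simp
  have neg: "u (- x) = - u x" for x using add[of x "- x"] u0 by simp
  have "linear u"
  proof (rule linearI)
    show "u (x + y) = u x + u y" for x y by (rule add)
    show "u (r *\<^sub>R x) = r *\<^sub>R u x" for r x
      using hom[of r x] hom[of "- r" x] neg[of "r *\<^sub>R x"] by (cases "r \<ge> 0") auto
  qed
  moreover have "u x \<le> p x" for x using u(2) p'(2) order_trans by blast
  moreover have "u a = p a"
  proof -
    have "p 0 = 0" using p by (rule sublinear_zero)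
    then have "u (- a) \<le> - p a" using u(2)[of "- a"] p'(3)[of "- a"] by simp
    then show ?thesis using neg \<open>u a \<le> p a\<close> by simp
  qed
  ultimately show ?thesis using that by blast
qed

definition bounded_cfunctional :: "('a::complex_banach \<Rightarrow> complex) \<Rightarrow> bool" where
  "bounded_cfunctional f \<longleftrightarrow> bounded_linear f \<and> (\<forall>c x. f (c *\<^sub>C x) = c * f x)"

text \<open>The real functional obtained from the norm becomes complex linear as
\<open>g x = u x - \<i> u (\<i> x)\<close>.\<close>
lemma separating_functional:
  fixes v :: "'a::complex_banach"
  assumes "v \<noteq> 0"
  obtains f where "bounded_cfunctional f" "f v = 1"
proof -
  have "sublinear (norm :: 'a \<Rightarrow> real)"
    by (auto simp: sublinear_def norm_triangle_ineq)
  then obtain u where u: "linear u" "\<And>x. u x \<le> norm (x::'a)" "u v = norm v"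
    using hahn_banach_sublinear by blast
  interpret u: linear u by fact
  define g where "g x = Complex (u x) (- u (\<i> *\<^sub>C x))" for x
  have ab: "\<bar>u x\<bar> \<le> norm x" for x
    using u(2)[of x] u(2)[of "- x"] by (simp add: u.neg)
  have gadd: "g (x + y) = g x + g y" for x y
    by (simp add: g_def u.add scaleC_add_right complex_eq_iff)
  have gR: "g (complex_of_real r *\<^sub>C x) = of_real r * g x" for r x
  proof -
    have "\<i> *\<^sub>C complex_of_real r *\<^sub>C x = r *\<^sub>R (\<i> *\<^sub>C x)"
      by (simp add: scaleC_scaleC scaleR_scaleC mult.commute)
    then show ?thesis
      by (simp add: g_def scaleR_scaleC[symmetric] u.scale complex_eq_iff)
  qed
  have gi: "g (\<i> *\<^sub>C x) = \<i> * g x" for x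
  proof -
    have "\<i> *\<^sub>C \<i> *\<^sub>C x = - x"
      using scaleR_scaleC[of "-1" x] by (simp add: scaleC_scaleC)
    then show ?thesis by (simp add: g_def u.neg complex_eq_iff)
  qed
  have gC: "g (c *\<^sub>C x) = c * g x" for c x
  proof -
    have "c *\<^sub>C x = complex_of_real (Re c) *\<^sub>C x + complex_of_real (Im c) *\<^sub>C \<i> *\<^sub>C x"
      by (metis complex_eq mult.commute scaleC_add_left scaleC_scaleC)
    then have "g (c *\<^sub>C x) = of_real (Re c) * g x + of_real (Im c) * (\<i> * g x)"
      by (simp only: gadd gR gi)
    also have "\<dots> = c * g x"
      by (metis (no_types, lifting) complex_eq distrib_right mult.assoc mult.commute)
    finally show ?thesis .
  qed
  have "bounded_linear g"
  proof (rule bounded_linear_intro[where K = 2])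
    show "g (r *\<^sub>R x) = r *\<^sub>R g x" for r x
      by (simp add: scaleR_scaleC gC scaleR_conv_of_real)
    show "norm (g x) \<le> norm x * 2" for x
      using cmod_le[of "g x"] ab[of x] ab[of "\<i> *\<^sub>C x"] by (simp add: g_def norm_scaleC)
  qed (rule gadd)
  then have bg: "bounded_cfunctional g" by (simp add: bounded_cfunctional_def gC)
  have gv: "g v \<noteq> 0" using u(3) assms by (simp add: g_def complex_eq_iff)
  show ?thesis
  proof (rule that[of "\<lambda>x. g x / g v"])
    show "bounded_cfunctional (\<lambda>x. g x / g v)"
      using bg unfolding bounded_cfunctional_def
      by (auto intro: bounded_linear_divide[THEN bounded_linear_compose])
  qed (use gv in simp)
qed

section \<open>Bounded complex-linear operators\<close>

lemma bounded_clinear_imp: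
  assumes "bounded_clinear T"
  shows "bounded_linear T" "T (x + y) = T x + T y" "T (x - y) = T x - T y" "T 0 = 0"
    "T (- x) = - T x" "T (c *\<^sub>C x) = c *\<^sub>C T x" "T (\<Sum>i\<in>I. g i) = (\<Sum>i\<in>I. T (g i))"
proof -
  show b: "bounded_linear T" using assms by (simp add: bounded_clinear_def)
  interpret bounded_linear T by (rule b)
  show "T (x + y) = T x + T y" "T (x - y) = T x - T y" "T 0 = 0" "T (- x) = - T x"
    by (simp_all add: add diff zero neg)
  show "T (c *\<^sub>C x) = c *\<^sub>C T x" using assms by (simp add: bounded_clinear_def)
  show "T (\<Sum>i\<in>I. g i) = (\<Sum>i\<in>I. T (g i))" by (rule sum)
qed

lemma bounded_linear_scaleC: "bounded_linear ((*\<^sub>C) c :: 'a::complex_banach \<Rightarrow> 'a)"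
  by (rule bounded_linear_intro[where K = "cmod c"])
    (simp_all add: scaleC_add_right scaleR_scaleC scaleC_scaleC norm_scaleC mult.commute)

lemma bounded_clinear_intros:
  "bounded_clinear (\<lambda>x. x)" "bounded_clinear (\<lambda>x. 0)"
  "bounded_clinear S \<Longrightarrow> bounded_clinear T \<Longrightarrow> bounded_clinear (\<lambda>x. S x + T x)"
  "bounded_clinear S \<Longrightarrow> bounded_clinear T \<Longrightarrow> bounded_clinear (\<lambda>x. S x - T x)"
  "bounded_clinear T \<Longrightarrow> bounded_clinear (\<lambda>x. - T x)"
  "bounded_clinear T \<Longrightarrow> bounded_clinear (\<lambda>x. c *\<^sub>C T x)"
  "bounded_clinear S \<Longrightarrow> bounded_clinear T \<Longrightarrow> bounded_clinear (\<lambda>x. S (T x))"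
  unfolding bounded_clinear_def
  by (auto intro: bounded_linear_add bounded_linear_sub bounded_linear_minus bounded_linear_ident
      bounded_linear_zero bounded_linear_compose bounded_linear_compose[OF bounded_linear_scaleC]
      simp: scaleC_add_right complex_vector.scale_right_diff_distrib scaleC_scaleC mult.commute)

lemma csubspace_imp_subspace: "csubspace S \<Longrightarrow> subspace S"
  by (auto simp: complex_vector.subspace_def subspace_def scaleR_scaleC)

lemma csubspace_kernel: "bounded_clinear T \<Longrightarrow> csubspace {x. T x = 0}"
  by (auto simp: complex_vector.subspace_def bounded_clinear_imp)

lemma csubspace_image: 
  assumes T: "bounded_clinear T" and S: "csubspace S" shows "csubspace (T ` S)"
proof (rule complex_vector.subspaceI)
  show "0 \<in> T ` S"
    by (rule image_eqI[of _ _ 0]) (simp_all add: bounded_clinear_imp(4)[OF T] complex_vector.subspace_0[OF S])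
  show "x + y \<in> T ` S" if "x \<in> T ` S" "y \<in> T ` S" for x y
    using that by (auto simp flip: bounded_clinear_imp(2)[OF T] intro!: imageI complex_vector.subspace_add[OF S])
  show "c *\<^sub>C x \<in> T ` S" if "x \<in> T ` S" for c x
    using that by (auto simp flip: bounded_clinear_imp(6)[OF T] intro!: imageI complex_vector.subspace_scale[OF S])
qed

lemma csubspace_vimage: 
  assumes "bounded_clinear T" "csubspace S" shows "csubspace {x. T x \<in> S}"
  using assms unfolding complex_vector.subspace_def by (simp add: bounded_clinear_imp)

lemma cspan_image:
  assumes T: "bounded_clinear T"
  shows "cspan (T ` B) = T ` cspan B"
proof
  show "cspan (T ` B) \<subseteq> T ` cspan B"
    by (intro complex_vector.span_minimal csubspace_image[OF T] image_mono
        complex_vector.span_superset complex_vector.subspace_span)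
  have "cspan B \<subseteq> {x. T x \<in> cspan (T ` B)}"
    by (intro complex_vector.span_minimal csubspace_vimage[OF T] complex_vector.subspace_span)
      (auto intro: complex_vector.span_base)
  then show "T ` cspan B \<subseteq> cspan (T ` B)" by auto
qed

section \<open>Dimension and codimension\<close>

text \<open>Independence of an indexed family: the single condition on linear combinations yields both that
the index map is injective and that its image is independent.\<close>
lemma independent_family:
  assumes B: "finite B" and z: "\<forall>u. (\<Sum>b\<in>B. u b *\<^sub>C \<phi> b) = 0 \<longrightarrow> (\<forall>b\<in>B. u b = 0)"
  shows "inj_on \<phi> B" "\<not> cdependent (\<phi> ` B)"
proof -
  show inj: "inj_on \<phi> B"
  proof (rule inj_onI, rule ccontr)
    fix b c assume h: "b \<in> B" "c \<in> B" "\<phi> b = \<phi> c" "b \<noteq> c"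
    define u where "u x = (if x = b then 1 else if x = c then -1 else (0::complex))" for x
    have "(\<Sum>x\<in>B. u x *\<^sub>C \<phi> x) = (\<Sum>x\<in>{b,c}. u x *\<^sub>C \<phi> x)"
      using h B by (intro sum.mono_neutral_right) (auto simp: u_def)
    also have "\<dots> = 0" using h by (simp add: u_def)
    finally have "u b = 0" using z h(1) by blast
    then show False by (simp add: u_def)
  qed
  show "\<not> cdependent (\<phi> ` B)"
  proof (rule complex_vector.independent_if_scalars_zero)
    fix f x assume "(\<Sum>x\<in>\<phi> ` B. f x *\<^sub>C x) = 0" "x \<in> \<phi> ` B"
    then show "f x = 0" using z[rule_format, of "f \<circ> \<phi>"] inj by (auto simp: sum.reindex)
  qed (use B in simp)
qed

lemma independent_sum_eq_0:
  assumes "finite B" "\<not> cdependent B" "(\<Sum>b\<in>B. u b *\<^sub>C b) = 0" "b \<in> B"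
  shows "u b = 0"
  using assms complex_vector.independentD by blast

lemma cspan_finiteE:
  assumes "finite B" "x \<in> cspan B"
  obtains u where "x = (\<Sum>b\<in>B. u b *\<^sub>C b)"
  using assms by (auto simp: complex_vector.span_finite)

text \<open>The coordinates of \<open>x\<close> with respect to \<open>S \<union> T\<close> are supported in \<open>S\<close> and also in \<open>T\<close>.\<close>
lemma cspan_disjoint:
  assumes ind: "\<not> cdependent (S \<union> T)" and dis: "S \<inter> T = {}"
    and x: "x \<in> cspan S" "x \<in> cspan T"
  shows "x = 0"
proof -
  have "crepresentation (S \<union> T) x = crepresentation S x"
      "crepresentation (S \<union> T) x = crepresentation T x"
    by (rule complex_vector.representation_extend[OF ind]; use x in simp)+
  then have "crepresentation S x b = 0" for b
    using dis complex_vector.representation_ne_zero[of S x b]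
      complex_vector.representation_ne_zero[of T x b] by fastforce
  then show ?thesis
    using complex_vector.sum_nonzero_representation_eq[of S x] ind x(1)
      complex_vector.independent_mono[OF ind] by simp
qed

lemma finite_cdim_basis:
  assumes "finite_cdim E"
  obtains B where "finite B" "\<not> cdependent B" "cspan B = E" "card B = cdim E"
proof -
  obtain G where G: "finite G" "cspan G = E" using assms by (auto simp: finite_cdim_def)
  obtain B where B: "B \<subseteq> G" "\<not> cdependent B" "G \<subseteq> cspan B"
    using complex_vector.maximal_independent_subset by metis
  have "cspan B = E"
    using B G by (metis complex_vector.span_mono complex_vector.span_span subset_antisym)
  moreover have "finite B" using B G finite_subset by blast
  ultimately show ?thesis using that B(2) complex_vector.dim_span_eq_card_independent by metis
qed

lemma finite_cdim_subspace:
  assumes N: "csubspace N" and sub: "N \<subseteq> E" and E: "finite_cdim E"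
  obtains B where "finite B" "\<not> cdependent B" "cspan B = N" "card B = cdim N"
proof -
  obtain G where G: "finite G" "cspan G = E" using E by (auto simp: finite_cdim_def)
  obtain B where B: "B \<subseteq> N" "\<not> cdependent B" "N \<subseteq> cspan B" "card B = cdim N"
    using complex_vector.basis_exists by metis
  have "finite B"
    using complex_vector.independent_span_bound[OF G(1) B(2)] B(1) sub G(2) by auto
  moreover have "cspan B = N"
    using B N by (simp add: complex_vector.span_minimal subset_antisym)
  ultimately show ?thesis using that B by blast
qed

lemma finite_cdim_subset: "csubspace N \<Longrightarrow> N \<subseteq> E \<Longrightarrow> finite_cdim E \<Longrightarrow> finite_cdim N"
  using finite_cdim_subspace[of N E] unfolding finite_cdim_def by blast

text \<open>Two complements of \<open>W\<close> are both isomorphic to the quotient by \<open>W\<close>.  Concretely, a basis of \<open>C\<close> is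
shifted along \<open>W\<close> into \<open>C'\<close>, where it stays independent because \<open>W\<close> meets \<open>C\<close> trivially.\<close>
lemma cdim_complement_le:
  assumes C: "direct_sum V W C" "finite_cdim C" and C': "direct_sum V W C'" "finite_cdim C'"
  shows "cdim C \<le> cdim C'"
proof -
  obtain B where B: "finite B" "\<not> cdependent B" "cspan B = C" "card B = cdim C"
    using finite_cdim_basis[OF C(2)] .
  obtain B' where B': "finite B'" "\<not> cdependent B'" "cspan B' = C'" "card B' = cdim C'"
    using finite_cdim_basis[OF C'(2)] .
  have W: "csubspace W" "W \<inter> C = {0}" using C(1) by (auto simp: direct_sum_def)
  have "\<exists>c'\<in>C'. b - c' \<in> W" if "b \<in> B" for b
  proof -
    have "0 \<in> W" using W by auto
    then have "0 + b \<in> V" using that B(3) complex_vector.span_base[of b B] C(1)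
      unfolding direct_sum_def by blast
    then obtain w c' where "b = w + c'" "w \<in> W" "c' \<in> C'"
      using C'(1) unfolding direct_sum_def by auto
    then show ?thesis by (intro bexI[of _ c']) auto
  qed
  then obtain \<phi> where \<phi>: "\<And>b. b \<in> B \<Longrightarrow> \<phi> b \<in> C' \<and> b - \<phi> b \<in> W" by metis
  have fam: "\<forall>u. (\<Sum>b\<in>B. u b *\<^sub>C \<phi> b) = 0 \<longrightarrow> (\<forall>b\<in>B. u b = 0)"
  proof (intro allI impI ballI)
    fix u b assume that: "(\<Sum>b\<in>B. u b *\<^sub>C \<phi> b) = 0" "b \<in> B"
    let ?x = "\<Sum>b\<in>B. u b *\<^sub>C b"
    have "?x = (\<Sum>b\<in>B. u b *\<^sub>C (b - \<phi> b))"
      using that(1) by (simp add: complex_vector.scale_right_diff_distrib sum_subtractf)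
    also have "\<dots> \<in> W"
      using \<phi> W(1) by (intro complex_vector.subspace_sum complex_vector.subspace_scale) auto
    finally have "?x \<in> W" .
    moreover have "?x \<in> C"
      unfolding B(3)[symmetric] by (intro complex_vector.span_sum complex_vector.span_scale complex_vector.span_base)
    ultimately have "?x = 0" using W(2) by blast
    then show "u b = 0" using independent_sum_eq_0[OF B(1,2)] that(2) by blast
  qed
  have "card (\<phi> ` B) \<le> card B'"
    using complex_vector.independent_span_bound[OF B'(1) independent_family(2)[of B \<phi>, OF B(1) fam]] \<phi> B'(3)
    by auto
  then show ?thesis
    using B(4) B'(4) card_image[OF independent_family(1)[of B \<phi>, OF B(1) fam]] by simp
qed

lemma ccodim_eq:
  assumes "direct_sum V W C" "finite_cdim C"
  shows "ccodim V W = cdim C"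
  unfolding ccodim_def
proof (rule the_equality)
  fix n assume "\<exists>C'. direct_sum V W C' \<and> finite_cdim C' \<and> cdim C' = n"
  then show "n = cdim C" using assms cdim_complement_le by (metis antisym)
qed (use assms in blast)

text \<open>A basis of \<open>W\<close> is extended to one of the whole space inside its union with \<open>B\<close>; the vectors
added lie in the finite set \<open>B\<close> and span a complement.\<close>
lemma finite_ccodim_if_finite_sum:
  assumes W: "csubspace W" and B: "finite B" and sum: "\<And>x. \<exists>w\<in>W. x - w \<in> cspan B"
  shows "finite_ccodim UNIV W"
proof -
  obtain D where D: "D \<subseteq> W" "\<not> cdependent D" "W \<subseteq> cspan D"
    using complex_vector.maximal_independent_subset by metis
  have W_eq: "cspan D = W" using D W by (simp add: complex_vector.span_minimal subset_antisym)
  obtain G where G: "D \<subseteq> G" "G \<subseteq> D \<union> B" "\<not> cdependent G" "D \<union> B \<subseteq> cspan G"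
    using complex_vector.maximal_independent_subset_extend[of D "D \<union> B"] D(2) by auto
  define C where "C = cspan (G - D)"
  have "x \<in> {w + c |w c. w \<in> W \<and> c \<in> C}" for x
  proof -
    obtain w where w: "w \<in> W" "x - w \<in> cspan B" using sum by blast
    have "w \<in> cspan G" using w(1) W_eq complex_vector.span_mono[OF G(1)] by blast
    moreover have "cspan B \<subseteq> cspan G"
      using G(4) by (intro complex_vector.span_minimal complex_vector.subspace_span) auto
    then have "x - w \<in> cspan G" using w(2) by blast
    ultimately have "w + (x - w) \<in> cspan (D \<union> (G - D))"
      using G(1) by (metis Diff_partition complex_vector.span_add)
    then show ?thesis unfolding complex_vector.span_Un C_def W_eq by auto
  qed
  moreover have "W \<inter> C = {0}"
  proof -
    have "x = 0" if "x \<in> W" "x \<in> C" for x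
      using that G(1,3) W_eq by (intro cspan_disjoint[of D "G - D" x]) (auto simp: C_def Un_absorb1)
    moreover have "0 \<in> W" "0 \<in> C" using W by (auto simp: C_def complex_vector.span_zero complex_vector.subspace_0)
    ultimately show ?thesis by blast
  qed
  ultimately have "direct_sum UNIV W C"
    using W unfolding direct_sum_def C_def by (auto simp: complex_vector.subspace_span)
  moreover have "finite (G - D)" using G(2) B by (auto intro: finite_subset[of _ B])
  then have "finite_cdim C" unfolding finite_cdim_def C_def by blast
  ultimately show ?thesis unfolding finite_ccodim_def by blast
qed

lemma injective_image_basis:
  assumes T: "bounded_clinear T" and inj: "\<And>x. x \<in> cspan B \<Longrightarrow> T x = 0 \<Longrightarrow> x = 0"
    and B: "finite B" "\<not> cdependent B"
  shows "\<not> cdependent (T ` B)" "card (T ` B) = card B"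
proof -
  have fam: "\<forall>u. (\<Sum>b\<in>B. u b *\<^sub>C T b) = 0 \<longrightarrow> (\<forall>b\<in>B. u b = 0)"
  proof (intro allI impI ballI)
    fix u b assume that: "(\<Sum>b\<in>B. u b *\<^sub>C T b) = 0" "b \<in> B"
    have "T (\<Sum>b\<in>B. u b *\<^sub>C b) = 0" using that by (simp add: bounded_clinear_imp[OF T])
    then have "(\<Sum>b\<in>B. u b *\<^sub>C b) = 0"
      by (rule inj[rotated]) (intro complex_vector.span_sum complex_vector.span_scale complex_vector.span_base)
    then show "u b = 0" using independent_sum_eq_0[OF B] that by blast
  qed
  show "\<not> cdependent (T ` B)" by (rule independent_family(2)[of B T, OF B(1) fam])
  show "card (T ` B) = card B"
    by (rule card_image[OF independent_family(1)[of B T, OF B(1) fam]])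
qed

section \<open>Finite-rank perturbations of bijections\<close>

lemma bounded_clinear_inv:
  assumes V: "bounded_clinear V" "bij V"
  shows "bounded_clinear (inv V)"
proof -
  have [simp]: "V (inv V y) = y" for y using V(2) by (simp add: bij_is_surj surj_f_inv_f)
  obtain K where K: "\<And>y. \<exists>x\<in>UNIV. V x = y \<and> norm x \<le> K * norm y"
    using open_mapping[OF bounded_clinear_imp(1)[OF V(1)] subspace_UNIV closed_UNIV bij_is_surj[OF V(2)]]
    by blast
  have inv_eq: "inv V y = x" if "V x = y" for x y
    using that V(2) by (metis bij_inv_eq_iff)
  have "bounded_linear (inv V)"
  proof (rule bounded_linear_intro)
    show "norm (inv V y) \<le> norm y * K" for y
      using K[of y] inv_eq by (auto simp: mult.commute)
    show "inv V (x + y) = inv V x + inv V y" for x y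
      by (rule inv_eq) (simp add: bounded_clinear_imp[OF V(1)])
    show "inv V (r *\<^sub>R x) = r *\<^sub>R inv V x" for r x
      by (rule inv_eq) (simp add: bounded_clinear_imp[OF V(1)] scaleR_scaleC)
  qed
  moreover have "inv V (c *\<^sub>C x) = c *\<^sub>C inv V x" for c x
    by (rule inv_eq) (simp add: bounded_clinear_imp[OF V(1)])
  ultimately show ?thesis by (simp add: bounded_clinear_def)
qed

text \<open>A finite-rank perturbation of a bijection has index zero.  Let \<open>E\<close> be a finite-dimensional space
containing the values of \<open>V - A\<close>, and \<open>E'\<close> its preimage under \<open>V\<close>, which has the same dimension.
Then \<open>A\<close> maps \<open>E'\<close> into \<open>E\<close>, its kernel lies in \<open>E'\<close>, and a complement of \<open>A ` E'\<close> in \<open>E\<close> is a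
complement of the whole range, so that counting a basis of \<open>E'\<close> that extends a basis of the
kernel gives the equality of the two dimensions.\<close>
lemma weyl_if_finite_rank_perturbation:
  assumes A: "bounded_clinear A" and V: "bounded_clinear V" "bij V"
    and F: "finite B0" "\<And>x. V x - A x \<in> cspan B0"
  shows "weyl A"
proof -
  define E where "E = cspan B0"
  define W where "W = inv V"
  have W: "bounded_clinear W" unfolding W_def using V by (rule bounded_clinear_inv)
  have VW: "V (W x) = x" "W (V x) = x" for x
    unfolding W_def using V(2) by (simp_all add: bij_is_surj bij_is_inj surj_f_inv_f)
  define E' where "E' = {x. V x \<in> E}"
  have sE: "csubspace E" unfolding E_def by (rule complex_vector.subspace_span)
  have fE: "finite_cdim E" using F(1) by (auto simp: E_def finite_cdim_def)
  obtain B1 where B1: "finite B1" "\<not> cdependent B1" "cspan B1 = E"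
    using finite_cdim_basis[OF fE] .
  have E'_eq: "E' = cspan (W ` B1)"
    unfolding cspan_image[OF W] B1(3) E'_def
  proof
    show "{x. V x \<in> E} \<subseteq> W ` E" using VW(2) by (metis imageI mem_Collect_eq subsetI)
  qed (use VW(1) in auto)
  have cardWB: "card (W ` B1) = card B1"
    by (rule injective_image_basis[OF W _ B1(1,2)]) (metis VW(1) bounded_clinear_imp(4) V(1))
  have fE': "finite_cdim E'" using B1(1) by (auto simp: E'_eq finite_cdim_def)
  have AE: "A x \<in> E" if "x \<in> E'" for x
    using complex_vector.subspace_diff[OF sE, of "V x" "V x - A x"] that F(2) by (simp add: E'_def E_def)
  have sN: "csubspace {x. A x = 0}" using A by (rule csubspace_kernel)
  have NE: "{x. A x = 0} \<subseteq> E'" 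
  proof
    fix x assume "x \<in> {x. A x = 0}"
    then show "x \<in> E'" using F(2)[of x] by (simp add: E'_def E_def)
  qed
  obtain BN where BN: "finite BN" "\<not> cdependent BN" "cspan BN = {x. A x = 0}" "card BN = cdim {x. A x = 0}"
    using finite_cdim_subspace[OF sN NE fE'] .
  have sE': "csubspace E'" unfolding E'_eq by (rule complex_vector.subspace_span)
  have "BN \<subseteq> E'" using BN(3) NE complex_vector.span_superset[of BN] by blast
  then obtain BE where BE: "BN \<subseteq> BE" "BE \<subseteq> E'" "\<not> cdependent BE" "E' \<subseteq> cspan BE"
    using complex_vector.maximal_independent_subset_extend[OF _ BN(2)] by metis
  have BE_eq: "cspan BE = E'" using BE sE' by (simp add: complex_vector.span_minimal subset_antisym)
  have finWB: "finite (W ` B1)" using B1 by simp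
  have finBE: "finite BE"
    using complex_vector.independent_span_bound[OF finWB BE(3)] BE(2) E'_eq by blast
  have cardBE: "card BE = card B1"
  proof -
    have "\<not> cdependent (W ` B1)"
      by (rule injective_image_basis[OF W _ B1(1,2)]) (metis VW(1) bounded_clinear_imp(4) V(1))
    then show ?thesis
      using BE_eq E'_eq cardWB BE(3) complex_vector.dim_span_eq_card_independent by metis
  qed
  \<comment> \<open>\<open>B2\<close> spans a complement of the kernel in \<open>E'\<close>, so \<open>A\<close> is injective on its span.\<close>
  define B2 where "B2 = BE - BN"
  have B2: "finite B2" "\<not> cdependent B2" "B2 \<inter> BN = {}" "B2 \<union> BN = BE"
    using finBE BE(1) complex_vector.independent_mono[OF BE(3)] by (auto simp: B2_def)
  have inj2: "x = 0" if "x \<in> cspan B2" "A x = 0" for x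
    using that B2 BE(3) BN(3) by (intro cspan_disjoint[of B2 BN x]) auto
  note AB2 = injective_image_basis[OF A inj2 B2(1,2)]
  have "B2 \<subseteq> E'" using BE(2) B2(4) by blast
  then have "A ` B2 \<subseteq> E" using AE by blast
  then obtain B3 where B3: "A ` B2 \<subseteq> B3" "B3 \<subseteq> E" "\<not> cdependent B3" "E \<subseteq> cspan B3"
    using complex_vector.maximal_independent_subset_extend[OF _ AB2(1)] by metis
  have B3_eq: "cspan B3 = E" using B3 sE by (simp add: complex_vector.span_minimal subset_antisym)
  have finB3: "finite B3"
    using complex_vector.independent_span_bound[OF B1(1) B3(3)] B3(2) B1(3) by blast
  have cardB3: "card B3 = card B1"
    using B3_eq B1(2,3) B3(3) complex_vector.dim_span_eq_card_independent by metis
  \<comment> \<open>\<open>B4\<close> completes \<open>A ` B2\<close> to a basis of \<open>E\<close>, so it has as many elements as \<open>BN\<close>.\<close>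
  define B4 where "B4 = B3 - A ` B2"
  have B4: "A ` B2 \<union> B4 = B3" "A ` B2 \<inter> B4 = {}" "finite B4" "\<not> cdependent B4"
    using B3(1) finB3 complex_vector.independent_mono[OF B3(3)] by (auto simp: B4_def)
  define D where "D = cspan B4"
  have "card B4 = card B3 - card (A ` B2)"
    unfolding B4_def using B3(1) finB3 by (simp add: card_Diff_subset finite_subset)
  moreover have "card B2 = card BE - card BN"
    unfolding B2_def using BE(1) finBE by (simp add: card_Diff_subset finite_subset)
  moreover have "card BN \<le> card BE" using BE(1) finBE by (simp add: card_mono)
  ultimately have "card B4 = card BN"
    using AB2(2) cardB3 cardBE by simp
  then have dimD: "cdim D = cdim {x. A x = 0}"
    unfolding D_def using B4(4) BN(4) by (simp add: complex_vector.dim_eq_card_independent)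
  have fD: "finite_cdim D" using B4(3) by (auto simp: D_def finite_cdim_def)
  have "direct_sum UNIV (range A) D"
    unfolding direct_sum_def
  proof (intro conjI)
    show "csubspace (range A)" using csubspace_image[OF A complex_vector.subspace_UNIV] .
    show "csubspace D" unfolding D_def by (rule complex_vector.subspace_span)
    have "y = 0" if y: "y \<in> range A" "y \<in> D" for y
    proof -
      obtain x where x: "y = A x" using y by blast
      have yE: "y \<in> E" using y(2) complex_vector.span_mono[of B4 B3] B4(1) B3_eq by (auto simp: D_def)
      have "V x \<in> E"
        using complex_vector.subspace_add[OF sE yE, of "V x - A x"] F(2) x by (simp add: E_def)
      then have "x \<in> cspan (B2 \<union> BN)" using B2(4) BE_eq by (simp add: E'_def)
      then obtain a b where ab: "x = a + b" "a \<in> cspan B2" "b \<in> cspan BN"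
        unfolding complex_vector.span_Un by blast
      then have "y = A a" using x BN(3) by (auto simp: bounded_clinear_imp[OF A])
      then have "y \<in> cspan (A ` B2)" using ab(2) cspan_image[OF A] by blast
      then show "y = 0"
        using y(2) B4 B3(3) by (intro cspan_disjoint[of "A ` B2" B4 y]) (auto simp: D_def)
    qed
    moreover have "0 \<in> range A" using bounded_clinear_imp(4)[OF A] by (metis rangeI)
    moreover have "0 \<in> D" by (simp add: D_def complex_vector.span_zero)
    ultimately show "range A \<inter> D = {0}" by blast
    have "y \<in> {w + c |w c. w \<in> range A \<and> c \<in> D}" for y
    proof -
      have "y - A (W y) \<in> E" using F(2)[of "W y"] by (simp add: VW E_def)
      then have "y - A (W y) \<in> cspan (A ` B2 \<union> B4)" using B4(1) B3_eq by simp
      then obtain a b where ab: "y - A (W y) = a + b" "a \<in> cspan (A ` B2)" "b \<in> D"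
        unfolding complex_vector.span_Un D_def by blast
      then obtain a' where "a = A a'" using cspan_image[OF A] by blast
      then have "y = A (W y + a') + b" using ab(1) by (simp add: bounded_clinear_imp[OF A] algebra_simps)
      then show ?thesis using ab(3) by blast
    qed
    then show "UNIV = {w + c |w c. w \<in> range A \<and> c \<in> D}" by blast
  qed
  moreover have "finite_cdim {x. A x = 0}" using BN by (auto simp: finite_cdim_def)
  ultimately show ?thesis
    using fD dimD ccodim_eq[of UNIV "range A" D]
    unfolding weyl_on_def fredholm_on_def fredholm_index_on_def ker_on_def finite_ccodim_def
    by auto
qed

section \<open>Dual functionals and finite-dimensional projections\<close>

lemma bounded_cfunctional_imp:
  assumes "bounded_cfunctional f"
  shows "f (x + y) = f x + f y" "f (x - y) = f x - f y" "f (c *\<^sub>C x) = c * f x" "f 0 = 0"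
    "f (\<Sum>i\<in>I. g i) = (\<Sum>i\<in>I. f (g i))"
proof -
  interpret bounded_linear f using assms by (simp add: bounded_cfunctional_def)
  show "f (x + y) = f x + f y" "f (x - y) = f x - f y" "f 0 = 0" 
    "f (\<Sum>i\<in>I. g i) = (\<Sum>i\<in>I. f (g i))"
    by (simp_all add: add diff zero sum)
  show "f (c *\<^sub>C x) = c * f x" using assms by (simp add: bounded_cfunctional_def)
qed

lemma bounded_cfunctional_intros:
  "bounded_cfunctional f \<Longrightarrow> bounded_cfunctional g \<Longrightarrow> bounded_cfunctional (\<lambda>x. f x - g x)"
  "bounded_cfunctional f \<Longrightarrow> bounded_cfunctional (\<lambda>x. f x * c)"
  "bounded_cfunctional f \<Longrightarrow> bounded_clinear T \<Longrightarrow> bounded_cfunctional (\<lambda>x. f (T x))"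
  unfolding bounded_cfunctional_def bounded_clinear_def
  by (auto intro: bounded_linear_sub bounded_linear_compose bounded_linear_compose[OF bounded_linear_mult_left]
      simp: right_diff_distrib)

lemma bounded_clinear_functional_scaleC:
  assumes "bounded_cfunctional f"
  shows "bounded_clinear (\<lambda>x. f x *\<^sub>C v)"
proof -
  have "bounded_linear (\<lambda>c. c *\<^sub>C v)"
    by (rule bounded_linear_intro[where K = "norm v"])
      (simp_all add: scaleC_add_left scaleR_scaleC scaleC_scaleC norm_scaleC scaleR_conv_of_real)
  then have "bounded_linear (\<lambda>x. f x *\<^sub>C v)"
    using assms bounded_linear_compose[of "\<lambda>c. c *\<^sub>C v" f] by (simp add: bounded_cfunctional_def)
  then show ?thesis
    using assms by (simp add: bounded_clinear_def bounded_cfunctional_def scaleC_scaleC)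
qed

lemma bounded_clinear_sum:
  "(\<And>i. i \<in> I \<Longrightarrow> bounded_clinear (T i)) \<Longrightarrow> bounded_clinear (\<lambda>x. \<Sum>i\<in>I. T i x)"
  by (induction I rule: infinite_finite_induct) (auto intro: bounded_clinear_intros)

text \<open>Induction on the basis.  The functionals for \<open>B\<close> define a projection \<open>P\<close> onto \<open>cspan B\<close>, and a new
vector \<open>b\<close> outside this span satisfies \<open>b - P b \<noteq> 0\<close>, so that a functional with value \<open>1\<close> at
\<open>b - P b\<close>, composed with \<open>x \<mapsto> x - P x\<close>, vanishes on \<open>B\<close> and equals \<open>1\<close> at \<open>b\<close>.  So the
Hahn-Banach theorem enters only through the separation of a nonzero vector from \<open>0\<close>.\<close>
lemma dual_functionals:
  assumes "finite B" "\<not> cdependent (B :: 'a::complex_banach set)"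
  obtains f where "\<And>b. b \<in> B \<Longrightarrow> bounded_cfunctional (f b)"
    "\<And>b c. b \<in> B \<Longrightarrow> c \<in> B \<Longrightarrow> f b c = (if b = c then 1 else 0)"
proof -
  have "\<exists>f. (\<forall>b\<in>B. bounded_cfunctional (f b)) \<and> (\<forall>b\<in>B. \<forall>c\<in>B. f b c = (if b = c then 1 else 0))"
    using assms
  proof (induction B rule: finite_induct)
    case empty
    then show ?case by simp
  next
    case (insert b B)
    have "\<not> cdependent B" using insert.prems complex_vector.independent_mono by blast
    then obtain f where f: "\<And>c. c \<in> B \<Longrightarrow> bounded_cfunctional (f c)"
        "\<And>c d. c \<in> B \<Longrightarrow> d \<in> B \<Longrightarrow> f c d = (if c = d then 1 else 0)"
      using insert.IH by blast
    define P where "P x = (\<Sum>c\<in>B. f c x *\<^sub>C c)" for x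
    have P: "bounded_clinear P"
      unfolding P_def by (intro bounded_clinear_sum bounded_clinear_functional_scaleC f)
    have Pc: "P c = c" if "c \<in> B" for c
    proof -
      have "P c = (\<Sum>d\<in>B. if d = c then c else 0)"
        unfolding P_def using that f(2) by (intro sum.cong) auto
      then show ?thesis using that insert.hyps(1) by simp
    qed
    have "P b \<in> cspan B"
      unfolding P_def by (intro complex_vector.span_sum complex_vector.span_scale complex_vector.span_base)
    moreover have "b \<notin> cspan B"
      using insert.prems insert.hyps(2) by (simp add: complex_vector.independent_insert)
    ultimately have "b - P b \<noteq> 0" by auto
    then obtain h where h: "bounded_cfunctional h" "h (b - P b) = 1"
      using separating_functional by blast
    define k where "k x = h (x - P x)" for x
    have k: "bounded_cfunctional k"
      unfolding k_def
      by (rule bounded_cfunctional_intros(3)[OF h(1) bounded_clinear_intros(4)[OF bounded_clinear_intros(1) P]])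
    have kb: "k b = 1" and kc: "\<And>c. c \<in> B \<Longrightarrow> k c = 0"
      using h Pc by (auto simp: k_def bounded_cfunctional_imp)
    define g where "g c = (if c = b then k else (\<lambda>x. f c x - k x * f c b))" for c
    have "\<forall>c\<in>insert b B. bounded_cfunctional (g c)"
      using k f(1) bounded_cfunctional_intros(1)[OF f(1) bounded_cfunctional_intros(2)[OF k]]
      by (simp add: g_def)
    moreover have "\<forall>c\<in>insert b B. \<forall>d\<in>insert b B. g c d = (if c = d then 1 else 0)"
      using kb kc f(2) insert.hyps(2) by (auto simp: g_def)
    ultimately show ?case by blast
  qed
  then show ?thesis using that by blast
qed

lemma dual_functionals_expand:
  assumes B: "finite B" and f: "\<And>b. b \<in> B \<Longrightarrow> bounded_cfunctional (f b)"
    and d: "\<And>b c. b \<in> B \<Longrightarrow> c \<in> B \<Longrightarrow> f b c = (if b = c then 1 else 0)"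
    and b: "b \<in> B"
  shows "f b (\<Sum>c\<in>B. u c *\<^sub>C c) = u b"
proof -
  have "f b (\<Sum>c\<in>B. u c *\<^sub>C c) = (\<Sum>c\<in>B. if c = b then u c else 0)"
    unfolding bounded_cfunctional_imp[OF f[OF b]] using b d by (intro sum.cong) auto
  then show ?thesis using B b by simp
qed

lemma finite_dim_projection:
  assumes "finite_cdim N"
  obtains P where "bounded_clinear P" "range P \<subseteq> N" "\<And>x. x \<in> N \<Longrightarrow> P x = x"
proof -
  obtain B where B: "finite B" "\<not> cdependent B" "cspan B = N"
    using finite_cdim_basis[OF assms] .
  obtain f where f: "\<And>b. b \<in> B \<Longrightarrow> bounded_cfunctional (f b)"
    "\<And>b c. b \<in> B \<Longrightarrow> c \<in> B \<Longrightarrow> f b c = (if b = c then 1 else 0)"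
    using dual_functionals[OF B(1,2)] by blast
  define P where "P x = (\<Sum>c\<in>B. f c x *\<^sub>C c)" for x
  show ?thesis
  proof (rule that)
    show "bounded_clinear P"
      unfolding P_def by (intro bounded_clinear_sum bounded_clinear_functional_scaleC f)
    show "range P \<subseteq> N"
      unfolding P_def B(3)[symmetric]
      by (auto intro: complex_vector.span_sum complex_vector.span_scale complex_vector.span_base)
    fix x assume "x \<in> N"
    then obtain u where u: "x = (\<Sum>c\<in>B. u c *\<^sub>C c)" using cspan_finiteE B(1,3) by blast
    show "P x = x"
      unfolding P_def u by (intro sum.cong) (auto simp: dual_functionals_expand[OF B(1) f])
  qed
qed

lemma finite_cdim_closed:
  assumes "finite_cdim N" shows "closed N"
proof -
  obtain P where P: "bounded_clinear P" "range P \<subseteq> N" "\<And>x. x \<in> N \<Longrightarrow> P x = x"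
    using finite_dim_projection[OF assms] by blast
  have "x \<in> N \<longleftrightarrow> P x = x" for x using P(2) P(3)[of x] by (metis rangeI subsetD)
  then have "N = {x. P x = x}" by blast
  moreover have "closed {x. P x = x}"
    using P(1) by (intro closed_Collect_eq) (auto intro: linear_continuous_on bounded_clinear_imp)
  ultimately show ?thesis by simp
qed

section \<open>Finite-rank operators\<close>

definition finite_rank :: "('a::complex_banach \<Rightarrow> 'a) \<Rightarrow> bool" where
  "finite_rank F \<longleftrightarrow> bounded_clinear F \<and> (\<exists>B. finite B \<and> range F \<subseteq> cspan B)"

lemma finite_rankI: "bounded_clinear F \<Longrightarrow> finite B \<Longrightarrow> (\<And>x. F x \<in> cspan B) \<Longrightarrow> finite_rank F"
  unfolding finite_rank_def by blast

lemma finite_rankE: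
  assumes "finite_rank F"
  obtains B where "finite B" "\<And>x. F x \<in> cspan B"
  using assms unfolding finite_rank_def by blast

lemma finite_rank_zero: "finite_rank (\<lambda>x. 0)"
  by (rule finite_rankI[of _ "{}"]) (auto intro: bounded_clinear_intros)

lemma finite_rank_add:
  assumes "finite_rank F" "finite_rank G" shows "finite_rank (\<lambda>x. F x + G x)"
proof -
  obtain B where B: "finite B" "\<And>x. F x \<in> cspan B" using finite_rankE[OF assms(1)] by blast
  obtain C where C: "finite C" "\<And>x. G x \<in> cspan C" using finite_rankE[OF assms(2)] by blast
  show ?thesis
  proof (rule finite_rankI)
    show "bounded_clinear (\<lambda>x. F x + G x)"
      using assms by (auto intro: bounded_clinear_intros simp: finite_rank_def)
    show "finite (B \<union> C)" using B C by simp
    show "F x + G x \<in> cspan (B \<union> C)" for x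
      using B(2) C(2) unfolding complex_vector.span_Un by blast
  qed
qed

lemma finite_rank_compose_left:
  assumes "finite_rank F" "bounded_clinear T" shows "finite_rank (\<lambda>x. T (F x))"
proof -
  obtain B where B: "finite B" "\<And>x. F x \<in> cspan B" using finite_rankE[OF assms(1)] by blast
  show ?thesis
  proof (rule finite_rankI)
    show "bounded_clinear (\<lambda>x. T (F x))"
      using assms by (auto intro: bounded_clinear_intros simp: finite_rank_def)
    show "finite (T ` B)" using B by simp
    show "T (F x) \<in> cspan (T ` B)" for x using B(2) cspan_image[OF assms(2)] by blast
  qed
qed

lemma finite_rank_compose_right:
  assumes "finite_rank F" "bounded_clinear T" shows "finite_rank (\<lambda>x. F (T x))"
  using assms by (auto simp: finite_rank_def intro: bounded_clinear_intros)

lemma finite_rank_minus: "finite_rank F \<Longrightarrow> finite_rank (\<lambda>x. - F x)"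
  using finite_rank_compose_left[of F "\<lambda>x. - x"] by (simp add: bounded_clinear_intros)

lemma finite_rank_diff: "finite_rank F \<Longrightarrow> finite_rank G \<Longrightarrow> finite_rank (\<lambda>x. F x - G x)"
  using finite_rank_add[of F "\<lambda>x. - G x"] by (simp add: finite_rank_minus)

section \<open>Fredholm operators as units modulo finite rank\<close>

text \<open>The kernel of \<open>A\<close> lies in the range of \<open>S A - 1\<close>, and the range of \<open>A\<close> together with that of
\<open>A S - 1\<close> spans the whole space.\<close>
lemma fredholm_if_inverse_mod_finite_rank:
  assumes A: "bounded_clinear A" 
    and l: "finite_rank (\<lambda>x. S (A x) - x)" and r: "finite_rank (\<lambda>x. A (S x) - x)" and S0: "S 0 = 0"
  shows "fredholm A"
proof -
  obtain B where B: "finite B" "\<And>x. S (A x) - x \<in> cspan B" using finite_rankE[OF l] by blast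
  obtain C where C: "finite C" "\<And>x. A (S x) - x \<in> cspan C" using finite_rankE[OF r] by blast
  have "finite_cdim (ker_on UNIV A)"
  proof (rule finite_cdim_subset)
    show "csubspace (ker_on UNIV A)" unfolding ker_on_def using csubspace_kernel[OF A] by simp
    show "finite_cdim (cspan B)" using B(1) by (auto simp: finite_cdim_def)
    show "ker_on UNIV A \<subseteq> cspan B"
    proof
      fix x assume "x \<in> ker_on UNIV A"
      then have "- x \<in> cspan B" using B(2)[of x] by (simp add: ker_on_def S0)
      then show "x \<in> cspan B" using complex_vector.span_neg by fastforce
    qed
  qed
  moreover have "finite_ccodim UNIV (range A)"
  proof (rule finite_ccodim_if_finite_sum[OF _ C(1)])
    show "csubspace (range A)" using csubspace_image[OF A complex_vector.subspace_UNIV] .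
    show "\<exists>w\<in>range A. x - w \<in> cspan C" for x
      using complex_vector.span_neg[OF C(2)[of x]] by (intro bexI[of _ "A (S x)"]) auto
  qed
  ultimately show ?thesis by (simp add: fredholm_on_def)
qed

text \<open>With \<open>Z\<close> a closed complement of the kernel and \<open>C\<close> a finite-dimensional complement of the range,
\<open>(z, c) \<mapsto> A z + c\<close> is a bijection from \<open>Z \<times> C\<close> onto the whole space.  The first component of its
inverse is \<open>S\<close>; the open mapping theorem bounds it.\<close>
lemma fredholm_imp_inverse_mod_finite_rank:
  assumes A: "bounded_clinear A" and fr: "fredholm A"
  obtains S where "bounded_clinear S" "finite_rank (\<lambda>x. S (A x) - x)" "finite_rank (\<lambda>x. A (S x) - x)"
proof -
  have fN: "finite_cdim {x. A x = 0}" using fr by (simp add: fredholm_on_def ker_on_def)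
  obtain C where C: "direct_sum UNIV (range A) C" "finite_cdim C"
    using fr by (auto simp: fredholm_on_def finite_ccodim_def)
  have sC: "csubspace C" and dis: "range A \<inter> C = {0}"
    and spans: "UNIV = {w + c |w c. w \<in> range A \<and> c \<in> C}"
    using C(1) by (auto simp: direct_sum_def)
  obtain P where P: "bounded_clinear P" "range P \<subseteq> {x. A x = 0}" "\<And>x. A x = 0 \<Longrightarrow> P x = x"
    using finite_dim_projection[OF fN] by auto
  have AP: "A (P x) = 0" for x using P(2) by auto
  define Z where "Z = {x. P x = 0}"
  have sZ: "csubspace Z" unfolding Z_def by (rule csubspace_kernel[OF P(1)])
  have cZ: "closed Z" unfolding Z_def
    using P(1) by (intro closed_Collect_eq) (auto intro: linear_continuous_on bounded_clinear_imp)
  have PZ: "x - P x \<in> Z" for x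
    using P(3)[OF AP] by (simp add: Z_def bounded_clinear_imp[OF P(1)])
  define f where "f p = A (fst p) + snd p" for p :: "'a \<times> 'a"
  have "bounded_linear f" unfolding f_def
    using bounded_clinear_imp(1)[OF A]
    by (intro bounded_linear_add bounded_linear_snd bounded_linear_compose[OF _ bounded_linear_fst])
  moreover have "subspace (Z \<times> C)"
    using sZ sC by (intro subspace_Times csubspace_imp_subspace)
  moreover have "closed (Z \<times> C)" using cZ finite_cdim_closed[OF C(2)] by (rule closed_Times)
  moreover have "f ` (Z \<times> C) = UNIV"
  proof -
    have "y \<in> f ` (Z \<times> C)" for y
    proof -
      obtain x c where "y = A x + c" "c \<in> C" using spans by blast
      then have "y = f (x - P x, c)" "(x - P x, c) \<in> Z \<times> C"
        using PZ by (auto simp: f_def bounded_clinear_imp[OF A] AP)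
      then show ?thesis by blast
    qed
    then show ?thesis by blast
  qed
  ultimately obtain K where K: "\<And>y. \<exists>p\<in>Z \<times> C. f p = y \<and> norm p \<le> K * norm y"
    using open_mapping[of f "Z \<times> C"] by blast
  then obtain g where g: "\<And>y. g y \<in> Z \<times> C" "\<And>y. f (g y) = y" "\<And>y. norm (g y) \<le> K * norm y"
    by metis
  define S where "S y = fst (g y)" for y
  have SZ: "S y \<in> Z" for y using g(1)[of y] by (auto simp: S_def mem_Times_iff)
  have SC: "y - A (S y) \<in> C" for y
  proof -
    have "y - A (S y) = snd (g y)" using g(2)[of y] by (simp add: S_def f_def algebra_simps)
    then show ?thesis using g(1)[of y] by (simp add: mem_Times_iff)
  qed
  have uniq: "z = z'" if z: "z \<in> Z" "z' \<in> Z" "y - A z \<in> C" "y - A z' \<in> C" for y z z'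
  proof -
    have "(y - A z) - (y - A z') \<in> C" using complex_vector.subspace_diff[OF sC that(3,4)] .
    moreover have "(y - A z) - (y - A z') = A (z' - z)" by (simp add: bounded_clinear_imp[OF A])
    ultimately have "A (z' - z) = 0" using dis by (metis IntI rangeI singletonD)
    moreover have "P (z' - z) = 0" using z by (simp add: Z_def bounded_clinear_imp[OF P(1)])
    ultimately show ?thesis using P(3) by fastforce
  qed
  have S_eq: "S y = z" if "z \<in> Z" "y - A z \<in> C" for y z
    using uniq[OF SZ that(1) SC that(2)] .
  have Sadd: "S (x + y) = S x + S y" for x y
  proof (rule S_eq)
    show "S x + S y \<in> Z" by (rule complex_vector.subspace_add[OF sZ SZ SZ])
    have "x + y - A (S x + S y) = (x - A (S x)) + (y - A (S y))" by (simp add: bounded_clinear_imp[OF A])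
    then show "x + y - A (S x + S y) \<in> C" using SC complex_vector.subspace_add[OF sC] by metis
  qed
  have Sscale: "S (c *\<^sub>C x) = c *\<^sub>C S x" for c x
  proof (rule S_eq)
    show "c *\<^sub>C S x \<in> Z" by (rule complex_vector.subspace_scale[OF sZ SZ])
    have "c *\<^sub>C x - A (c *\<^sub>C S x) = c *\<^sub>C (x - A (S x))"
      by (simp add: bounded_clinear_imp[OF A] complex_vector.scale_right_diff_distrib)
    then show "c *\<^sub>C x - A (c *\<^sub>C S x) \<in> C" using SC complex_vector.subspace_scale[OF sC] by metis
  qed
  have S: "bounded_clinear S"
  proof -
    have "norm (S y) \<le> norm y * K" for y
      using g(3)[of y] norm_fst_le[of "fst (g y)" "snd (g y)"] by (simp add: S_def mult.commute)
    then have "bounded_linear S"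
      by (intro bounded_linear_intro[where K = K]) (simp_all add: Sadd Sscale scaleR_scaleC)
    then show ?thesis by (simp add: bounded_clinear_def Sscale)
  qed
  have SA: "S (A x) = x - P x" for x
    by (rule S_eq) (use PZ sC in \<open>auto simp: bounded_clinear_imp[OF A] AP complex_vector.subspace_0\<close>)
  obtain BN where BN: "finite BN" "cspan BN = {x. A x = 0}" using fN by (auto simp: finite_cdim_def)
  obtain BC where BC: "finite BC" "cspan BC = C" using C(2) by (auto simp: finite_cdim_def)
  show ?thesis
  proof (rule that[OF S])
    show "finite_rank (\<lambda>x. S (A x) - x)"
    proof (rule finite_rankI[OF _ BN(1)])
      show "bounded_clinear (\<lambda>x. S (A x) - x)" 
        by (rule bounded_clinear_intros(4)[OF bounded_clinear_intros(7)[OF S A] bounded_clinear_intros(1)])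
      show "S (A x) - x \<in> cspan BN" for x
        using AP by (simp add: SA BN(2) bounded_clinear_imp[OF A])
    qed
    show "finite_rank (\<lambda>x. A (S x) - x)"
    proof (rule finite_rankI[OF _ BC(1)])
      show "bounded_clinear (\<lambda>x. A (S x) - x)" 
        by (rule bounded_clinear_intros(4)[OF bounded_clinear_intros(7)[OF A S] bounded_clinear_intros(1)])
      show "A (S x) - x \<in> cspan BC" for x
        using complex_vector.subspace_neg[OF sC SC[of x]] by (simp add: BC(2))
    qed
  qed
qed

text \<open>At index zero, a bijection between a basis of the kernel and a basis of a complement of the range
gives, through the dual functionals of the former, a finite-rank operator which fills both gaps.\<close>
lemma weyl_imp_bijective_mod_finite_rank:
  assumes A: "bounded_clinear A" and w: "weyl A"
  obtains V where "bounded_clinear V" "bij V" "finite_rank (\<lambda>x. V x - A x)"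
proof -
  have fr: "fredholm A" and ind: "fredholm_index_on UNIV A = 0" using w by (auto simp: weyl_on_def)
  have fN: "finite_cdim {x. A x = 0}" using fr by (simp add: fredholm_on_def ker_on_def)
  obtain C where C: "direct_sum UNIV (range A) C" "finite_cdim C"
    using fr by (auto simp: fredholm_on_def finite_ccodim_def)
  have sC: "csubspace C" and dis: "range A \<inter> C = {0}"
    and spans: "UNIV = {w + c |w c. w \<in> range A \<and> c \<in> C}"
    using C(1) by (auto simp: direct_sum_def)
  obtain BN where BN: "finite BN" "\<not> cdependent BN" "cspan BN = {x. A x = 0}" "card BN = cdim {x. A x = 0}"
    using finite_cdim_basis[OF fN] .
  obtain BC where BC: "finite BC" "\<not> cdependent BC" "cspan BC = C" "card BC = cdim C"
    using finite_cdim_basis[OF C(2)] .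
  have "card BN = card BC"
    using ind ccodim_eq[OF C] BN(4) BC(4) by (simp add: fredholm_index_on_def ker_on_def)
  then obtain \<beta> where \<beta>: "bij_betw \<beta> BN BC" using BN(1) BC(1) finite_same_card_bij by blast
  obtain f where f: "\<And>b. b \<in> BN \<Longrightarrow> bounded_cfunctional (f b)"
    "\<And>b c. b \<in> BN \<Longrightarrow> c \<in> BN \<Longrightarrow> f b c = (if b = c then 1 else 0)"
    using dual_functionals[OF BN(1,2)] by blast
  define F where "F x = (\<Sum>b\<in>BN. f b x *\<^sub>C \<beta> b)" for x
  have F: "bounded_clinear F"
    unfolding F_def by (intro bounded_clinear_sum bounded_clinear_functional_scaleC f)
  have FC: "F x \<in> cspan BC" for x
    unfolding F_def using \<beta>
    by (intro complex_vector.span_sum complex_vector.span_scale complex_vector.span_base) (auto simp: bij_betw_def)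
  define V where "V x = A x + F x" for x
  have V: "bounded_clinear V" unfolding V_def using A F by (rule bounded_clinear_intros)
  have "x = 0" if "V x = 0" for x
  proof -
    have "F x = A (- x)" using that by (simp add: V_def bounded_clinear_imp[OF A] eq_neg_iff_add_eq_0 add.commute)
    then have Fx: "F x = 0" using FC[of x] dis BC(3) by (metis IntI rangeI singletonD)
    then have "x \<in> cspan BN" using that BN(3) by (simp add: V_def)
    then obtain u where u: "x = (\<Sum>b\<in>BN. u b *\<^sub>C b)" using cspan_finiteE BN(1) by blast
    have "(\<Sum>c\<in>BC. f (inv_into BN \<beta> c) x *\<^sub>C c) = (\<Sum>b\<in>BN. f (inv_into BN \<beta> (\<beta> b)) x *\<^sub>C \<beta> b)"
      using sum.reindex_bij_betw[OF \<beta>, of "\<lambda>c. f (inv_into BN \<beta> c) x *\<^sub>C c"] by simp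
    also have "\<dots> = F x"
      unfolding F_def using \<beta> by (intro sum.cong) (auto simp: bij_betw_inv_into_left)
    finally have sum0: "(\<Sum>c\<in>BC. f (inv_into BN \<beta> c) x *\<^sub>C c) = 0" using Fx by simp
    have "u b = 0" if "b \<in> BN" for b
    proof -
      have "\<beta> b \<in> BC" using \<beta> that by (auto simp: bij_betw_def)
      then have "f b x = 0"
        using independent_sum_eq_0[OF BC(1,2) sum0] \<beta> that by (fastforce simp: bij_betw_inv_into_left)
      then show ?thesis
        using dual_functionals_expand[OF BN(1) f that, of u] u by simp
    qed
    then show "x = 0" using u by simp
  qed
  then have "inj V"
    by (intro injI) (metis bounded_clinear_imp(3)[OF V] right_minus_eq)
  moreover have "surj V"
    unfolding surj_def
  proof
    fix y
    obtain x c where y: "y = A x + c" "c \<in> C" using spans by blast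
    obtain v where v: "c = (\<Sum>d\<in>BC. v d *\<^sub>C d)" using cspan_finiteE BC(1,3) y(2) by blast
    \<comment> \<open>The vector of the kernel that corrects the coordinates of \<open>F x\<close> to those of \<open>c\<close>.\<close>
    define z where "z = (\<Sum>b\<in>BN. (v (\<beta> b) - f b x) *\<^sub>C b)"
    have "z \<in> cspan BN" unfolding z_def
      by (intro complex_vector.span_sum complex_vector.span_scale complex_vector.span_base)
    then have Az: "A z = 0" using BN(3) by simp
    have "F (x + z) = (\<Sum>b\<in>BN. v (\<beta> b) *\<^sub>C \<beta> b)"
      unfolding F_def
    proof (intro sum.cong refl)
      fix b assume b: "b \<in> BN"
      have "f b z = v (\<beta> b) - f b x"
        unfolding z_def by (rule dual_functionals_expand[OF BN(1) f b])
      then show "f b (x + z) *\<^sub>C \<beta> b = v (\<beta> b) *\<^sub>C \<beta> b"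
        by (simp add: bounded_cfunctional_imp[OF f(1)[OF b]])
    qed
    also have "\<dots> = c" unfolding v by (rule sum.reindex_bij_betw[OF \<beta>])
    finally have "V (x + z) = y" using Az y by (simp add: V_def bounded_clinear_imp[OF A])
    then show "\<exists>x. y = V x" by blast
  qed
  ultimately have "bij V" by (rule bijI)
  moreover have "finite_rank (\<lambda>x. V x - A x)"
    by (rule finite_rankI[of _ BC]) (use F FC BC in \<open>auto simp: V_def\<close>)
  ultimately show ?thesis using that V by blast
qed

section \<open>Contractions and direct sums\<close>

text \<open>Solving \<open>x - E x = y\<close> means finding the fixed point of the contraction \<open>x \<mapsto> y + E x\<close>.\<close>
lemma contraction_bij:
  assumes E: "bounded_clinear E" and q: "q < 1" "\<And>x. norm (E x) \<le> q * norm x"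
  shows "bij (\<lambda>x. x - E x)"
proof -
  have ex1: "\<exists>!x. y + E x = x" for y
  proof (rule banach_fix_type)
    show "0 \<le> max q 0" "max q 0 < 1" using q by auto
    have "norm (E (a - b)) \<le> max q 0 * norm (a - b)" for a b
      using q(2)[of "a - b"] mult_right_mono[of q "max q 0" "norm (a - b)"] by simp
    then show "\<forall>a b. dist (y + E a) (y + E b) \<le> max q 0 * dist a b"
      by (simp add: dist_norm bounded_clinear_imp[OF E])
  qed
  have "y + E x = x \<longleftrightarrow> x - E x = y" for x y by (auto simp: algebra_simps)
  then have "\<exists>!x. x - E x = y" for y using ex1[of y] by simp
  then show ?thesis by (simp add: bij_iff)
qed

text \<open>The addition map is a bounded bijection from \<open>X1 \<times> X2\<close> onto the space; the open mapping theorem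
bounds its inverse, whose first component is the projection.\<close>
lemma direct_sum_projection:
  assumes ds: "direct_sum UNIV X1 X2" and cl: "closed X1" "closed X2"
  obtains P where "bounded_clinear P" "\<And>x. P x \<in> X1" "\<And>x. x - P x \<in> X2"
    "\<And>x. x \<in> X1 \<Longrightarrow> P x = x" "\<And>x. x \<in> X2 \<Longrightarrow> P x = 0"
proof -
  have s: "csubspace X1" "csubspace X2" and dis: "X1 \<inter> X2 = {0}"
    and spans: "UNIV = {w + c |w c. w \<in> X1 \<and> c \<in> X2}"
    using ds by (auto simp: direct_sum_def)
  define f where "f p = fst p + snd p" for p :: "'a \<times> 'a"
  have "bounded_linear f" unfolding f_def
    by (intro bounded_linear_add bounded_linear_snd bounded_linear_fst)
  moreover have "subspace (X1 \<times> X2)"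
    using s by (intro subspace_Times csubspace_imp_subspace)
  moreover have "closed (X1 \<times> X2)" using cl by (rule closed_Times)
  moreover have "f ` (X1 \<times> X2) = UNIV"
  proof -
    have "y \<in> f ` (X1 \<times> X2)" for y
    proof -
      obtain w c where "y = w + c" "w \<in> X1" "c \<in> X2" using spans by blast
      then show ?thesis by (intro image_eqI[of _ _ "(w, c)"]) (auto simp: f_def)
    qed
    then show ?thesis by blast
  qed
  ultimately obtain K where "\<And>y. \<exists>p\<in>X1 \<times> X2. f p = y \<and> norm p \<le> K * norm y"
    using open_mapping[of f "X1 \<times> X2"] by blast
  then obtain g where g: "\<And>y. g y \<in> X1 \<times> X2" "\<And>y. f (g y) = y" "\<And>y. norm (g y) \<le> K * norm y"
    by metis
  define P where "P y = fst (g y)" for y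
  have P1: "P y \<in> X1" for y using g(1)[of y] by (auto simp: P_def mem_Times_iff)
  have P2: "y - P y \<in> X2" for y
    
  proof -
    have "y - P y = snd (g y)" using g(2)[of y] by (simp add: P_def f_def algebra_simps)
    then show ?thesis using g(1)[of y] by (simp add: mem_Times_iff)
  qed
  have P_eq: "P y = z" if "z \<in> X1" "y - z \<in> X2" for y z
  proof -
    have "P y - z \<in> X1" using complex_vector.subspace_diff[OF s(1) P1 that(1)] .
    moreover have "P y - z \<in> X2"
      using complex_vector.subspace_diff[OF s(2) that(2) P2[of y]] by simp
    ultimately show ?thesis using dis by (metis IntI right_minus_eq singletonD)
  qed
  have Padd: "P (x + y) = P x + P y" for x y
  proof (rule P_eq)
    show "P x + P y \<in> X1" by (rule complex_vector.subspace_add[OF s(1) P1 P1])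
    show "x + y - (P x + P y) \<in> X2"
      using complex_vector.subspace_add[OF s(2) P2[of x] P2[of y]] by (simp add: algebra_simps)
  qed
  have Pscale: "P (c *\<^sub>C x) = c *\<^sub>C P x" for c x
  proof (rule P_eq)
    show "c *\<^sub>C P x \<in> X1" by (rule complex_vector.subspace_scale[OF s(1) P1])
    show "c *\<^sub>C x - c *\<^sub>C P x \<in> X2"
      using complex_vector.subspace_scale[OF s(2) P2[of x], of c]
      by (simp add: complex_vector.scale_right_diff_distrib)
  qed
  have "norm (P y) \<le> norm y * K" for y
    using g(3)[of y] norm_fst_le[of "fst (g y)" "snd (g y)"] by (simp add: P_def mult.commute)
  then have "bounded_linear P"
    by (intro bounded_linear_intro[where K = K]) (simp_all add: Padd Pscale scaleR_scaleC)
  then have "bounded_clinear P" by (simp add: bounded_clinear_def Pscale)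
  then show ?thesis
  proof (rule that[OF _ P1 P2])
    show "P x = x" if "x \<in> X1" for x
      by (rule P_eq) (use that s in \<open>auto simp: complex_vector.subspace_0\<close>)
    show "P x = 0" if "x \<in> X2" for x
      by (rule P_eq) (use that s in \<open>auto simp: complex_vector.subspace_0\<close>)
  qed
qed

section \<open>Spectral radius in seminormed complex algebras\<close>

lemma sum_power_roots_of_unity:
  assumes "0 < j" "j < n"
  shows "(\<Sum>k<n. cis (2 * pi * real k / real n) ^ j) = 0"
proof -
  define z where "z = cis (2 * pi * real j / real n)"
  have "cis (2 * pi * real k / real n) ^ j = z ^ k" for k
    by (simp add: z_def Complex.DeMoivre mult_ac)
  moreover have "z ^ n = 1"
  proof -
    have "z ^ n = cis (2 * pi * real j)" using assms by (simp add: z_def Complex.DeMoivre)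
    then show ?thesis by (simp add: cis_multiple_2pi)
  qed
  moreover have "z \<noteq> 1"
  proof
    assume "z = 1"
    then obtain x :: int where "2 * pi * real j / real n = 2 * pi * x"
      using cis_conv_exp exp_eq_1[of "\<i> * (2 * pi * real j / real n)"] by (auto simp: z_def)
    then have "real j = real_of_int x * real n" using assms by (simp add: field_simps)
    then have "int j = x * int n" by (metis of_int_eq_iff of_int_mult of_int_of_nat_eq)
    then have "int n dvd int j" by simp
    then show False using assms zdvd_imp_le by fastforce
  qed
  ultimately show ?thesis by (simp add: geometric_sum)
qed

lemma commuting_power_mult:
  fixes a r :: "'b::monoid_mult"
  assumes "a * r = r * a"
  shows "(a * r) ^ n = a ^ n * r ^ n"
proof (induction n)
  case (Suc n)
  have "(a * r) ^ Suc n = a * (r * a ^ n) * r ^ n" using Suc by (simp add: mult.assoc)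
  also have "r * a ^ n = a ^ n * r" using power_commuting_commutes[OF assms] by simp
  finally show ?case by (simp add: mult.assoc)
qed simp

lemma geometric_factorization:
  fixes x :: "'b::{ring,monoid_mult}"
  shows "(1 - x) * (\<Sum>j<n. x ^ j) = 1 - x ^ n" "(\<Sum>j<n. x ^ j) * (1 - x) = 1 - x ^ n"
proof -
  show "(1 - x) * (\<Sum>j<n. x ^ j) = 1 - x ^ n"
  proof (induction n)
    case (Suc n)
    show ?case unfolding sum.lessThan_Suc distrib_left Suc.IH by (simp add: left_diff_distrib)
  qed simp
  show "(\<Sum>j<n. x ^ j) * (1 - x) = 1 - x ^ n"
  proof (induction n)
    case (Suc n)
    show ?case unfolding sum.lessThan_Suc distrib_right Suc.IH
      by (simp add: right_diff_distrib power_commutes)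
  qed simp
qed

definition invertible_elem :: "'b::monoid_mult \<Rightarrow> bool" where
  "invertible_elem x \<longleftrightarrow> (\<exists>y. x * y = 1 \<and> y * x = 1)"

lemma invertible_elem_if_one_sided:
  assumes "x * y = 1" "z * x = (1 :: 'b::monoid_mult)" shows "invertible_elem x"
proof -
  have "z * (x * y) = (z * x) * y" by (simp only: mult.assoc)
  then have "z = y" using assms by simp
  then show ?thesis using assms invertible_elem_def by blast
qed

lemma invertible_elem_mult:
  assumes "invertible_elem x" "invertible_elem (y :: 'b::monoid_mult)" shows "invertible_elem (x * y)"
proof -
  obtain x' y' where "x * x' = 1" "x' * x = 1" "y * y' = 1" "y' * y = 1"
    using assms by (auto simp: invertible_elem_def)
  then have "(x * y) * (y' * x') = 1" "(y' * x') * (x * y) = 1"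
    by (metis mult.assoc mult.left_neutral)+
  then show ?thesis unfolding invertible_elem_def by blast
qed

text \<open>An algebra with a submultiplicative seminorm.  The scalars are elements \<open>sc a\<close> of the centre, so
that scalar multiplication is ring multiplication.  The axioms fit the bounded operators modulo
finite rank: the seminorm vanishes on the classes of all norm limits of finite-rank operators, and
the quotient is the zero ring, with \<open>p 1 = 0\<close>, if the space has finite dimension.\<close>
locale seminormed_complex_algebra =
  fixes sc :: "complex \<Rightarrow> 'b::{ring,monoid_mult}" and p :: "'b \<Rightarrow> real"
  assumes sc_add: "sc (a + b) = sc a + sc b"
    and sc_mult: "sc (a * b) = sc a * sc b"
    and sc_1: "sc 1 = 1"
    and sc_commute: "sc a * x = x * sc a"
    and p_add: "p (x + y) \<le> p x + p y"
    and p_mult: "p (x * y) \<le> p x * p y"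
    and p_scale_le: "p (sc a * x) \<le> cmod a * p x"
    and p_1: "p 1 \<le> 1"
begin

lemma sc_0: "sc 0 = 0" using sc_add[of 0 0] by simp
lemma sc_minus: "sc (- a) = - sc a" using sc_add[of a "- a"] sc_0 by (simp add: eq_neg_iff_add_eq_0 add.commute)
lemma sc_diff: "sc (a - b) = sc a - sc b" using sc_add[of a "- b"] sc_minus by simp
lemma sc_sum: "sc (\<Sum>i\<in>I. f i) = (\<Sum>i\<in>I. sc (f i))"
  by (induction I rule: infinite_finite_induct) (auto simp: sc_add sc_0)
lemma sc_power: "sc (a ^ n) = sc a ^ n" by (induction n) (auto simp: sc_1 sc_mult)
lemma p_0: "p 0 = 0" using p_scale_le[of 0 0] p_add[of 0 0] by simp
lemma p_minus: "p (- x) = p x"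
  using p_scale_le[of "-1" x] p_scale_le[of "-1" "- x"] by (simp add: sc_minus sc_1)
lemma p_nonneg: "0 \<le> p x" using p_add[of x "- x"] by (simp add: p_0 p_minus)
lemma p_scale: "p (sc a * x) = cmod a * p x"
proof (cases "a = 0")
  case False
  have "p x \<le> cmod (1 / a) * p (sc a * x)"
    using p_scale_le[of "1 / a" "sc a * x"] False by (simp add: sc_1 flip: mult.assoc sc_mult)
  then have "cmod a * p x \<le> p (sc a * x)" using False by (simp add: norm_divide field_simps)
  then show ?thesis using p_scale_le[of a x] by simp
qed (simp add: sc_0 p_0)
lemma p_diff: "p (x - y) \<le> p x + p y" using p_add[of x "- y"] by (simp add: p_minus)
lemma p_sum: "p (\<Sum>i\<in>I. f i) \<le> (\<Sum>i\<in>I. p (f i))"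
  by (induction I rule: infinite_finite_induct) (auto simp: p_0 intro: order_trans[OF p_add])

lemma p_power: "n > 0 \<Longrightarrow> p (x ^ n) \<le> p x ^ n"
proof (induction n rule: nat_induct_non_zero)
  case (Suc n)
  have "p (x ^ Suc n) \<le> p x * p (x ^ n)" by (simp add: p_mult)
  also have "\<dots> \<le> p x * p x ^ n" using Suc.IH by (rule mult_left_mono[OF _ p_nonneg])
  finally show ?case by simp
qed simp

context
  fixes r :: 'b and G :: "complex \<Rightarrow> 'b"
  assumes G: "G z * (1 - sc z * r) = 1" "(1 - sc z * r) * G z = 1"
begin

text \<open>The resolvent identity \<open>G w - G z = (w - z) G w r G z\<close>.  It yields a bound for \<open>G\<close> near each
point, hence on every disc, and then a Lipschitz constant for \<open>G\<close> on that disc.\<close>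
lemma resolvent_difference: "p (G w - G z) \<le> cmod (w - z) * (p (G w) * p r * p (G z))"
proof -
  have "G w - G z = G w * ((1 - sc z * r) * G z) - (G w * (1 - sc w * r)) * G z"
    by (simp add: G)
  also have "\<dots> = G w * (sc (w - z) * r) * G z"
    by (simp add: sc_diff algebra_simps)
  also have "\<dots> = sc (w - z) * (G w * r * G z)"
    by (simp add: mult.assoc flip: sc_commute[of "w - z" "G w"]) (metis mult.assoc sc_commute)
  finally have "p (G w - G z) = cmod (w - z) * p (G w * r * G z)"
    by (simp only: p_scale)
  also have "p (G w * r * G z) \<le> p (G w) * p r * p (G z)"
    by (meson order_trans p_mult p_nonneg mult_right_mono)
  finally show ?thesis by (simp add: mult_left_mono)
qed

lemma resolvent_locally_bounded:
  assumes "cmod (w - z) * (p r * p (G z)) \<le> 1 / 2"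
  shows "p (G w) \<le> 2 * p (G z)"
proof -
  have "p (G w) \<le> p (G z) + p (G w - G z)" using p_add[of "G z" "G w - G z"] by simp
  also have "\<dots> \<le> p (G z) + p (G w) * (cmod (w - z) * (p r * p (G z)))"
    using resolvent_difference[of w z] by (simp add: mult_ac)
  also have "\<dots> \<le> p (G z) + p (G w) * (1 / 2)"
    by (intro add_left_mono mult_left_mono assms p_nonneg)
  finally show ?thesis by simp
qed

lemma resolvent_lipschitz:
  obtains L where "L \<ge> 0"
    "\<And>w z. cmod w \<le> \<rho> \<Longrightarrow> cmod z \<le> \<rho> \<Longrightarrow> p (G w - G z) \<le> L * cmod (w - z)"
proof -
  \<comment> \<open>Adding \<open>1\<close> keeps the radius meaningful where \<open>p r * p (G z)\<close> vanishes.\<close>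
  define d where "d z = 1 / (2 * (1 + p r * p (G z)))" for z
  have pos: "1 + p r * p (G z) > 0" for z using p_nonneg[of r] p_nonneg[of "G z"] by (simp add: add_pos_nonneg)
  have d: "d z > 0" for z using pos[of z] by (simp add: d_def)
  have loc: "p (G w) \<le> 2 * p (G z)" if "w \<in> ball z (d z)" for w z
  proof (rule resolvent_locally_bounded)
    have "cmod (w - z) * (p r * p (G z)) \<le> d z * (1 + p r * p (G z))"
      using that p_nonneg[of r] p_nonneg[of "G z"] less_imp_le[OF d] by (intro mult_mono) (auto simp: dist_norm norm_minus_commute)
    also have "\<dots> = 1 / 2" using pos[of z] by (simp add: d_def field_simps)
    finally show "cmod (w - z) * (p r * p (G z)) \<le> 1 / 2" .
  qed
  have "cball 0 \<rho> \<subseteq> (\<Union>z\<in>cball 0 \<rho>. ball z (d z))" using d by (auto intro!: bexI)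
  then obtain D where D: "D \<subseteq> cball 0 \<rho>" "finite D" "cball 0 \<rho> \<subseteq> (\<Union>z\<in>D. ball z (d z))"
    using compactE_image[OF compact_cball, of "cball 0 \<rho>" "\<lambda>z. ball z (d z)" 0 \<rho>] by (metis open_ball)
  define M where "M = (\<Sum>z\<in>D. 2 * p (G z))"
  have M: "p (G w) \<le> M" if "cmod w \<le> \<rho>" for w
  proof -
    have "w \<in> cball 0 \<rho>" using that by simp
    then obtain z where z: "z \<in> D" "w \<in> ball z (d z)" using D(3) by blast
    have "2 * p (G z) \<le> M" unfolding M_def
      by (rule member_le_sum[OF z(1) _ D(2)]) (simp add: p_nonneg)
    then show ?thesis using loc[OF z(2)] by simp
  qed
  have M0: "M \<ge> 0" unfolding M_def by (intro sum_nonneg) (simp add: p_nonneg)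
  show ?thesis
  proof (rule that[of "M * p r * M"])
    show "M * p r * M \<ge> 0" using M0 p_nonneg by simp
    fix w z assume "cmod w \<le> \<rho>" "cmod z \<le> \<rho>"
    then have "p (G w) * p r * p (G z) \<le> M * p r * M"
      using M M0 p_nonneg by (intro mult_mono) auto
    then have "cmod (w - z) * (p (G w) * p r * p (G z)) \<le> cmod (w - z) * (M * p r * M)"
      by (rule mult_left_mono) simp
    then show "p (G w - G z) \<le> M * p r * M * cmod (w - z)"
      using resolvent_difference[of w z] by (simp add: mult_ac)
  qed
qed

text \<open>The average of the resolvent over the points \<open>\<omega> s\<close> with \<open>\<omega>\<close> an \<open>n\<close>-th root of unity, an algebraic
substitute for Cauchy's integral over the circle of radius \<open>s\<close>.\<close>
definition resolvent_mean :: "nat \<Rightarrow> real \<Rightarrow> 'b" where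
  "resolvent_mean n s = sc (1 / of_nat n) * (\<Sum>k<n. G (cis (2 * pi * real k / real n) * of_real s))"

text \<open>The identity \<open>1/n \<Sum> 1 / (1 - \<omega> x) = 1 / (1 - x\<^sup>n)\<close>, summed over the \<open>n\<close>-th roots of unity: since
\<open>\<omega>\<^sup>n = 1\<close>, the element \<open>1 - \<omega> x\<close> divides \<open>1 - x\<^sup>n\<close> with quotient a geometric sum, and averaging over
\<open>\<omega>\<close> removes all its terms except the first.\<close>
lemma resolvent_mean_inverse:
  assumes n: "n > 0"
  shows "resolvent_mean n s * (1 - sc (of_real s ^ n) * r ^ n) = 1"
proof -
  define \<omega> where "\<omega> k = cis (2 * pi * real k / real n)" for k
  have \<omega>n: "\<omega> k ^ n = 1" for k
  proof -
    have "\<omega> k ^ n = cis (2 * pi * real k)" using n by (simp add: \<omega>_def Complex.DeMoivre)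
    then show ?thesis by (simp add: cis_multiple_2pi)
  qed
  have pw: "(sc z * r) ^ j = sc (z ^ j) * r ^ j" for z j
    using commuting_power_mult[OF sc_commute] by (simp add: sc_power)
  have each: "G (\<omega> k * of_real s) * (1 - sc (of_real s ^ n) * r ^ n)
      = (\<Sum>j<n. sc (of_real s ^ j) * (sc (\<omega> k ^ j) * r ^ j))" for k
  proof -
    let ?z = "\<omega> k * of_real s"
    have "1 - sc (of_real s ^ n) * r ^ n = (1 - sc ?z * r) * (\<Sum>j<n. (sc ?z * r) ^ j)"
      using geometric_factorization(1)[of "sc ?z * r" n] pw[of ?z n]
      by (simp add: power_mult_distrib \<omega>n)
    then have "G ?z * (1 - sc (of_real s ^ n) * r ^ n) = (\<Sum>j<n. (sc ?z * r) ^ j)"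
      by (simp add: G flip: mult.assoc)
    also have "\<dots> = (\<Sum>j<n. sc (of_real s ^ j) * (sc (\<omega> k ^ j) * r ^ j))"
    proof (intro sum.cong refl)
      fix j
      have "?z ^ j = of_real s ^ j * \<omega> k ^ j" by (simp add: power_mult_distrib mult.commute)
      then show "(sc ?z * r) ^ j = sc (of_real s ^ j) * (sc (\<omega> k ^ j) * r ^ j)"
        unfolding pw by (simp only: sc_mult mult.assoc)
    qed
    finally show ?thesis .
  qed
  have "(\<Sum>k<n. G (\<omega> k * of_real s)) * (1 - sc (of_real s ^ n) * r ^ n)
      = (\<Sum>k<n. \<Sum>j<n. sc (of_real s ^ j) * (sc (\<omega> k ^ j) * r ^ j))"
    unfolding sum_distrib_right each ..
  also have "\<dots> = (\<Sum>j<n. sc (of_real s ^ j) * (sc (\<Sum>k<n. \<omega> k ^ j) * r ^ j))"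
    unfolding sc_sum sum_distrib_right sum_distrib_left by (rule sum.swap)
  also have "\<dots> = (\<Sum>j<n. if j = 0 then sc (of_nat n) else 0)"
    using sum_power_roots_of_unity[of _ n]
    by (intro sum.cong refl) (auto simp: \<omega>_def sc_0 sc_1)
  also have "\<dots> = sc (of_nat n)" using n by simp
  finally have "resolvent_mean n s * (1 - sc (of_real s ^ n) * r ^ n) = sc (1 / of_nat n) * sc (of_nat n)"
    by (simp add: resolvent_mean_def \<omega>_def mult.assoc)
  then show ?thesis using n by (simp add: sc_1 flip: sc_mult)
qed

lemma resolvent_mean_lipschitz:
  assumes L: "\<And>w z. cmod w \<le> \<rho> \<Longrightarrow> cmod z \<le> \<rho> \<Longrightarrow> p (G w - G z) \<le> L * cmod (w - z)"
    and st: "\<bar>s\<bar> \<le> \<rho>" "\<bar>t\<bar> \<le> \<rho>" and n: "n > 0"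
  shows "p (resolvent_mean n s - resolvent_mean n t) \<le> L * \<bar>s - t\<bar>"
proof -
  define \<omega> where "\<omega> k = cis (2 * pi * real k / real n)" for k
  have "p (resolvent_mean n s - resolvent_mean n t)
      = (1 / n) * p (\<Sum>k<n. G (\<omega> k * of_real s) - G (\<omega> k * of_real t))"
    using n by (simp add: resolvent_mean_def \<omega>_def sum_subtractf p_scale norm_divide flip: right_diff_distrib)
  also have "\<dots> \<le> (1 / n) * (\<Sum>k<n. L * \<bar>s - t\<bar>)"
  proof (intro mult_left_mono order_trans[OF p_sum] sum_mono)
    fix k
    have "cmod (\<omega> k * of_real s - \<omega> k * of_real t) = \<bar>s - t\<bar>"
      by (simp add: \<omega>_def norm_mult flip: right_diff_distrib of_real_diff)
    then show "p (G (\<omega> k * of_real s) - G (\<omega> k * of_real t)) \<le> L * \<bar>s - t\<bar>"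
      using L[of "\<omega> k * of_real s" "\<omega> k * of_real t"] st by (simp add: \<omega>_def norm_mult)
  qed simp
  also have "\<dots> = L * \<bar>s - t\<bar>" using n by simp
  finally show ?thesis .
qed

text \<open>With \<open>A\<close> the mean and \<open>X = s\<^sup>n r\<^sup>n\<close>, the equation \<open>A (1 - X) = 1\<close> says that \<open>X\<close> is small if and only
if \<open>A\<close> is close to \<open>1\<close>, with constants that do not depend on \<open>n\<close>.\<close>
lemma resolvent_mean_bounds:
  assumes n: "n > 0" and s: "s \<ge> 0"
  shows "p (r ^ n) * s ^ n \<le> 1 / 5 \<Longrightarrow> p (resolvent_mean n s - 1) \<le> 1 / 4"
    and "p (resolvent_mean n s - 1) \<le> 1 / 2 \<Longrightarrow> p (r ^ n) * s ^ n \<le> 1"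
proof -
  define A X where "A = resolvent_mean n s" and "X = sc (of_real s ^ n) * r ^ n"
  define h f where "h = p (A - 1)" and "f = p (r ^ n) * s ^ n"
  have AX: "A - 1 = A * X"
    using resolvent_mean_inverse[OF n, of s] by (simp add: A_def X_def algebra_simps)
  have f: "p X = f" using s by (simp add: X_def f_def p_scale norm_power mult.commute)
  have h0: "h \<ge> 0" and f0: "f \<ge> 0" using p_nonneg f by (auto simp: h_def f[symmetric])
  have "p A \<le> h + 1" using p_add[of "A - 1" 1] p_1 by (simp add: h_def)
  have "h \<le> p A * f" using p_mult[of A X] by (simp add: h_def AX f)
  also have "\<dots> \<le> (h + 1) * f" using \<open>p A \<le> h + 1\<close> f0 by (rule mult_right_mono)
  finally have 1: "h \<le> (h + 1) * f" .
  have "(A - 1) * X = (A - 1) - X" unfolding left_diff_distrib AX[symmetric] by simp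
  then have "X = (A - 1) - (A - 1) * X" by simp
  then have "f \<le> h + p ((A - 1) * X)" using p_diff[of "A - 1" "(A - 1) * X"] f by (simp add: h_def)
  also have "\<dots> \<le> h + h * f" using p_mult[of "A - 1" X] by (simp add: h_def f)
  finally have 2: "f \<le> h + h * f" .
  show "p (resolvent_mean n s - 1) \<le> 1 / 4" if "p (r ^ n) * s ^ n \<le> 1 / 5"
  proof -
    have "(h + 1) * f \<le> (h + 1) * (1 / 5)" using that h0 by (intro mult_left_mono) (auto simp: f_def)
    then show ?thesis using 1 by (simp add: h_def A_def)
  qed
  show "p (r ^ n) * s ^ n \<le> 1" if "p (resolvent_mean n s - 1) \<le> 1 / 2"
  proof -
    have "h * f \<le> (1 / 2) * f" using that f0 by (intro mult_right_mono) (auto simp: h_def A_def)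
    then show ?thesis using 2 that by (simp add: h_def A_def f_def)
  qed
qed

text \<open>If \<open>p (r ^ n) * s ^ n\<close> is small for large \<open>n\<close>, then the means at radius \<open>s\<close> are near \<open>1\<close>.  All means
share one Lipschitz constant, so they stay near \<open>1\<close> at a slightly larger radius \<open>t\<close>, which bounds
\<open>p (r ^ n) * t ^ n\<close>; and then the same expression tends to \<open>0\<close> at radii below \<open>t\<close>.  The step width
is uniform, so finitely many steps lead from the radius \<open>0\<close> to \<open>c\<close>.\<close>
lemma quasinilpotent_growth:
  assumes c: "c \<ge> 0"
  obtains n where "n > 0" "p (r ^ n) * c ^ n < 1"
proof -
  obtain L where L: "L \<ge> 0"
    "\<And>w z. cmod w \<le> c + 1 \<Longrightarrow> cmod z \<le> c + 1 \<Longrightarrow> p (G w - G z) \<le> L * cmod (w - z)"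
    using resolvent_lipschitz[of "c + 1"] by blast
  obtain N :: nat where N: "real N > max (8 * L * c) (2 * c)" using reals_Archimedean2 by blast
  then have N0: "N > 0" using c by (cases N) auto
  define \<delta> where "\<delta> = c / N"
  have \<delta>: "\<delta> \<ge> 0" "real N * \<delta> = c" using c N0 by (auto simp: \<delta>_def)
  have \<delta>1: "2 * \<delta> \<le> 1" "L * (2 * \<delta>) \<le> 1 / 4"
    using N N0 by (auto simp: \<delta>_def field_simps)
  have "\<forall>\<^sub>F n in sequentially. p (r ^ n) * (real m * \<delta>) ^ n \<le> 1 / 5" if "m \<le> N" for m
    using that
  proof (induction m)
    case 0
    show ?case by (rule eventually_mono[OF eventually_gt_at_top[of 0]]) (simp add: zero_power)
  next
    case (Suc m)
    have IH: "\<forall>\<^sub>F n in sequentially. p (r ^ n) * (real m * \<delta>) ^ n \<le> 1 / 5" using Suc by simp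
    \<comment> \<open>The mean is compared at distance \<open>2 \<delta>\<close>, one step beyond the radius aimed at, so that the
        quotient of the two radii makes the bound \<open>1\<close> at \<open>t\<close> decay geometrically.\<close>
    define s t where "s = real m * \<delta>" and "t = (real m + 2) * \<delta>"
    have "s \<le> t" "0 \<le> s" using \<delta> by (auto simp: s_def t_def intro: mult_right_mono)
    have "(real m + 1) * \<delta> \<le> real N * \<delta>" using Suc.prems \<delta> by (intro mult_right_mono) auto
    then have tc: "t \<le> c + 1" using \<delta> \<delta>1 by (simp add: t_def algebra_simps)
    have step: "((real m + 1) / (real m + 2)) ^ n \<le> 1 / 5 \<and> n > 0 \<longrightarrow> p (r ^ n) * s ^ n \<le> 1 / 5 \<longrightarrow>
        p (r ^ n) * (real (Suc m) * \<delta>) ^ n \<le> 1 / 5" for n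
    proof (intro impI, elim conjE)
      assume n: "((real m + 1) / (real m + 2)) ^ n \<le> 1 / 5" "n > 0" and small: "p (r ^ n) * s ^ n \<le> 1 / 5"
      have "p (resolvent_mean n s - 1) \<le> 1 / 4"
        using resolvent_mean_bounds(1)[OF n(2) \<open>0 \<le> s\<close> small] .
      moreover have "p (resolvent_mean n t - resolvent_mean n s) \<le> L * \<bar>t - s\<bar>"
        using L(2) tc \<open>s \<le> t\<close> \<open>0 \<le> s\<close> n(2) by (intro resolvent_mean_lipschitz[where \<rho> = "c + 1"]) auto
      moreover have "L * \<bar>t - s\<bar> \<le> 1 / 4"
        using \<delta>1 \<delta> by (simp add: s_def t_def flip: left_diff_distrib)
      moreover have "p (resolvent_mean n t - 1) \<le> p (resolvent_mean n s - 1) + p (resolvent_mean n t - resolvent_mean n s)"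
        using p_add[of "resolvent_mean n s - 1" "resolvent_mean n t - resolvent_mean n s"] by simp
      ultimately have "p (r ^ n) * t ^ n \<le> 1"
        using \<open>s \<le> t\<close> \<open>0 \<le> s\<close> by (intro resolvent_mean_bounds(2)[OF n(2)]) auto
      have eqt: "real (Suc m) * \<delta> = (real m + 1) / (real m + 2) * t"
        by (simp add: t_def)
      have "p (r ^ n) * (real (Suc m) * \<delta>) ^ n = (p (r ^ n) * t ^ n) * ((real m + 1) / (real m + 2)) ^ n"
        unfolding eqt power_mult_distrib by (simp only: mult_ac)
      also have "\<dots> \<le> 1 * (1 / 5)"
        using \<open>p (r ^ n) * t ^ n \<le> 1\<close> n(1) by (intro mult_mono) auto
      finally show "p (r ^ n) * (real (Suc m) * \<delta>) ^ n \<le> 1 / 5" by simp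
    qed
    have ev: "\<forall>\<^sub>F n in sequentially. ((real m + 1) / (real m + 2)) ^ n \<le> 1 / 5"
    proof -
      have "(\<lambda>n. ((real m + 1) / (real m + 2)) ^ n) \<longlonglongrightarrow> 0"
        by (rule LIMSEQ_realpow_zero) auto
      then have "\<forall>\<^sub>F n in sequentially. ((real m + 1) / (real m + 2)) ^ n < 1 / 5"
        by (rule order_tendstoD) simp
      then show ?thesis by (rule eventually_mono) simp
    qed
    show ?case
      using IH[folded s_def] ev eventually_gt_at_top[of 0] by eventually_elim (use step in blast)
  qed
  from this[of N] have "\<forall>\<^sub>F n in sequentially. p (r ^ n) * c ^ n \<le> 1 / 5" using \<delta> by simp
  then have "\<forall>\<^sub>F n in sequentially. n > 0 \<and> p (r ^ n) * c ^ n \<le> 1 / 5"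
    using eventually_gt_at_top by (rule eventually_conj[rotated])
  then obtain n where "n > 0" "p (r ^ n) * c ^ n \<le> 1 / 5"
    using eventually_happens'[OF sequentially_bot] by blast
  then show ?thesis using that[of n] by simp
qed

end

end

section \<open>Perturbation of units and open subgroups\<close>

text \<open>A subgroup \<open>W\<close> of the unit group that is open, which for a subgroup amounts to containing a ball
around \<open>1\<close>.\<close>
locale open_unit_subgroup = seminormed_complex_algebra sc p
  for sc :: "complex \<Rightarrow> 'b::{ring,monoid_mult}" and p +
  fixes W :: "'b set"
  assumes W_inverse: "x \<in> W \<Longrightarrow> \<exists>y\<in>W. x * y = 1 \<and> y * x = 1"
    and W_mult: "x \<in> W \<Longrightarrow> y \<in> W \<Longrightarrow> x * y \<in> W"
    and W_near_1: "p (x - 1) < 1 \<Longrightarrow> x \<in> W"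
begin

lemma W_invertible: "x \<in> W \<Longrightarrow> invertible_elem x"
  using W_inverse invertible_elem_def by blast

text \<open>\<open>u + d = u (1 + v d)\<close>, and the second factor lies in the ball around \<open>1\<close>.\<close>
lemma small_perturbation:
  assumes v: "u * v = 1" "v * u = 1" and small: "p v * p d < 1"
  shows "invertible_elem (u + d)" "u + d \<in> W \<longleftrightarrow> u \<in> W"
proof -
  define w where "w = 1 + v * d"
  have eq: "u + d = u * w" by (simp add: w_def distrib_left v flip: mult.assoc)
  have "p (w - 1) < 1" using p_mult[of v d] small by (simp add: w_def)
  then have w: "w \<in> W" by (rule W_near_1)
  have u: "invertible_elem u" using v invertible_elem_def by blast
  show "invertible_elem (u + d)" unfolding eq by (rule invertible_elem_mult[OF u W_invertible[OF w]])
  obtain w' where w': "w' \<in> W" "w * w' = 1" using W_inverse[OF w] by blast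
  have "u = (u + d) * w'" by (simp add: eq mult.assoc w')
  then show "u + d \<in> W \<longleftrightarrow> u \<in> W" using W_mult w w'(1) eq by metis
qed

text \<open>The element \<open>1 - x\<close> is a factor, on both sides, of \<open>1 - x ^ n\<close>, which lies in \<open>W\<close>.\<close>
lemma invertible_if_power_small:
  assumes "n > 0" "p (x ^ n) < 1"
  shows "invertible_elem (1 - x)"
proof -
  have "1 - x ^ n \<in> W" using assms(2) by (intro W_near_1) (simp add: p_minus)
  then obtain y where y: "(1 - x ^ n) * y = 1" "y * (1 - x ^ n) = 1" using W_inverse by blast
  show ?thesis
  proof (rule invertible_elem_if_one_sided)
    show "(1 - x) * ((\<Sum>j<n. x ^ j) * y) = 1"
      using y(1) by (simp add: geometric_factorization flip: mult.assoc)
    show "(y * (\<Sum>j<n. x ^ j)) * (1 - x) = 1"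
      using y(2) by (simp add: geometric_factorization mult.assoc)
  qed
qed

text \<open>Along the whole segment, \<open>u + t r = u (1 + t v r)\<close> is invertible, because \<open>v = u\<^sup>-\<^sup>1\<close> commutes with
\<open>r\<close> and so a power of \<open>t v r\<close> has seminorm below \<open>1\<close>.  Membership in the open subgroup \<open>W\<close> is
locally constant on units, hence constant on the segment.\<close>
lemma quasinilpotent_perturbation:
  assumes u: "invertible_elem u" and comm: "u * r = r * u"
    and r: "\<And>z. invertible_elem (1 - sc z * r)"
  shows "invertible_elem (u + r)" "u + r \<in> W \<longleftrightarrow> u \<in> W"
proof -
  obtain v where v: "u * v = 1" "v * u = 1" using u invertible_elem_def by blast
  have vr: "v * r = r * v"
  proof -
    have "v * r = v * (r * u) * v" by (simp add: mult.assoc v)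
    also have "\<dots> = (v * u) * (r * v)" by (simp add: mult.assoc flip: comm)
    finally show ?thesis using v by simp
  qed
  obtain G where G: "\<And>z. G z * (1 - sc z * r) = 1" "\<And>z. (1 - sc z * r) * G z = 1"
    using r unfolding invertible_elem_def by metis
  have inv: "invertible_elem (u + sc z * r)" for z
  proof -
    define a where "a = sc (- z) * v"
    have ar: "a * r = r * a" by (simp add: a_def mult.assoc vr) (metis mult.assoc sc_commute)
    have eq: "u + sc z * r = u * (1 - a * r)"
    proof -
      have "u * (a * r) = sc (- z) * ((u * v) * r)" unfolding a_def by (metis mult.assoc sc_commute)
      then show ?thesis by (simp add: right_diff_distrib v sc_minus)
    qed
    obtain n where n: "n > 0" "p (r ^ n) * p a ^ n < 1"
      using quasinilpotent_growth[OF G p_nonneg[of a]] by blast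
    have "p ((a * r) ^ n) \<le> p (a ^ n) * p (r ^ n)" unfolding commuting_power_mult[OF ar] by (rule p_mult)
    also have "\<dots> \<le> p a ^ n * p (r ^ n)" by (rule mult_right_mono[OF p_power[OF n(1)] p_nonneg])
    also have "\<dots> < 1" using n(2) by (simp add: mult.commute)
    finally have "invertible_elem (1 - a * r)" using n(1) by (rule invertible_if_power_small[rotated])
    then show ?thesis unfolding eq using u by (rule invertible_elem_mult[rotated])
  qed
  show "invertible_elem (u + r)" using inv[of 1] by (simp add: sc_1)
  define f where "f t = (u + sc (of_real t) * r \<in> W)" for t :: real
  have "f 0 = f 1"
  proof (rule connected_local_const[of "{0..1::real}"])
    show "\<forall>s\<in>{0..1}. \<forall>\<^sub>F t in at s within {0..1}. f s = f t"
    proof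
      fix s :: real
      obtain y where y: "(u + sc (of_real s) * r) * y = 1" "y * (u + sc (of_real s) * r) = 1"
        using inv[of "of_real s"] invertible_elem_def by blast
      define d where "d = 1 / (1 + p y * p r)"
      have pos: "1 + p y * p r > 0" using p_nonneg[of r] p_nonneg[of y] by (simp add: add_pos_nonneg)
      have "f s = f t" if t: "dist t s < d" for t
      proof -
        have "p y * p (sc (of_real (t - s)) * r) = \<bar>t - s\<bar> * (p y * p r)"
          unfolding p_scale norm_of_real by simp
        also have "\<dots> \<le> \<bar>t - s\<bar> * (1 + p y * p r)" by (simp add: mult_left_mono)
        also have "\<dots> < d * (1 + p y * p r)"
          using t pos by (intro mult_strict_right_mono) (auto simp: dist_real_def)
        also have "\<dots> = 1" using pos by (simp add: d_def)
        finally have *: "u + sc (of_real s) * r + sc (of_real (t - s)) * r \<in> W \<longleftrightarrow> u + sc (of_real s) * r \<in> W"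
          by (rule small_perturbation(2)[OF y])
        have eqt: "u + sc (of_real s) * r + sc (of_real (t - s)) * r = u + sc (of_real t) * r"
          by (simp add: add.assoc flip: distrib_right sc_add)
        show ?thesis using * unfolding eqt f_def by blast
      qed
      moreover have "d > 0" using pos by (simp add: d_def)
      ultimately show "\<forall>\<^sub>F t in at s within {0..1}. f s = f t"
        unfolding eventually_at by blast
    qed
  qed auto
  then show "u + r \<in> W \<longleftrightarrow> u \<in> W" by (simp add: f_def sc_0 sc_1)
qed

text \<open>The converse direction undoes the perturbation by \<open>r\<close> with the perturbation by \<open>- r\<close>.\<close>
lemma quasinilpotent_perturbation_iff:
  assumes comm: "u * r = r * u" and r: "\<And>z. invertible_elem (1 - sc z * r)"
  shows "invertible_elem (u + r) \<longleftrightarrow> invertible_elem u" "u + r \<in> W \<longleftrightarrow> u \<in> W"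
proof -
  have neg: "invertible_elem (1 - sc z * (- r))" for z using r[of "- z"] by (simp add: sc_minus)
  have "(u + r) * (- r) = (- r) * (u + r)" using comm by (simp add: algebra_simps)
  from quasinilpotent_perturbation(1)[OF _ this neg] quasinilpotent_perturbation(1)[OF _ comm r]
  show i: "invertible_elem (u + r) \<longleftrightarrow> invertible_elem u" by auto
  show "u + r \<in> W \<longleftrightarrow> u \<in> W"
    using quasinilpotent_perturbation(2)[OF _ comm r] W_invertible i by blast
qed

end

section \<open>The bounded operators modulo finite rank\<close>

text \<open>The distance, in operator norm, from \<open>f\<close> to the finite-rank operators.\<close>
definition essential_norm :: "('a::complex_banach \<Rightarrow> 'a) \<Rightarrow> real" where
  "essential_norm f = Inf {a. a \<ge> 0 \<and> (\<exists>F. finite_rank F \<and> (\<forall>x. norm (f x - F x) \<le> a * norm x))}"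

lemma essential_norm_le:
  assumes "finite_rank F" "a \<ge> 0" "\<And>x. norm (f x - F x) \<le> a * norm x"
  shows "essential_norm f \<le> a"
  unfolding essential_norm_def
  by (rule cInf_lower) (use assms in \<open>auto intro!: bdd_belowI[of _ 0]\<close>)

lemma essential_norm_approx:
  assumes f: "bounded_clinear f" and c: "essential_norm f < c"
  obtains F a where "finite_rank F" "0 \<le> a" "a < c" "\<And>x. norm (f x - F x) \<le> a * norm x"
proof -
  let ?S = "{a. a \<ge> 0 \<and> (\<exists>F. finite_rank F \<and> (\<forall>x. norm (f x - F x) \<le> a * norm x))}"
  obtain K where K: "K \<ge> 0" "\<And>x. norm (f x) \<le> norm x * K"
    using bounded_linear.nonneg_bounded[OF bounded_clinear_imp(1)[OF f]] by blast
  have "K \<in> ?S"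
    using K finite_rank_zero by (auto simp: mult.commute intro!: exI[of _ "\<lambda>x. 0"])
  then have "\<exists>a\<in>?S. a < c"
    using c unfolding essential_norm_def by (metis (no_types, lifting) cInf_lessD empty_iff)
  then show ?thesis using that by blast
qed

lemma essential_norm_nonneg:
  assumes "bounded_clinear f" shows "0 \<le> essential_norm f"
proof (rule ccontr)
  assume "\<not> 0 \<le> essential_norm f"
  then show False using essential_norm_approx[OF assms, of 0] by (metis not_le)
qed

lemma essential_norm_cong:
  assumes "finite_rank (\<lambda>x. f x - g x)" shows "essential_norm f = essential_norm g"
proof -
  have *: "\<exists>F. finite_rank F \<and> (\<forall>x. norm (g x - F x) \<le> a * norm x)"
    if "finite_rank (\<lambda>x. f x - g x)" "finite_rank F" "\<forall>x. norm (f x - F x) \<le> a * norm x" for F a f g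
    using that finite_rank_diff[OF that(2,1)] by (intro exI[of _ "\<lambda>x. F x - (f x - g x)"]) simp
  have sym: "finite_rank (\<lambda>x. g x - f x)" using finite_rank_minus[OF assms] by simp
  have "(\<exists>F. finite_rank F \<and> (\<forall>x. norm (f x - F x) \<le> a * norm x)) \<longleftrightarrow>
      (\<exists>F. finite_rank F \<and> (\<forall>x. norm (g x - F x) \<le> a * norm x))" for a
    using *[OF assms] *[OF sym] by blast
  then show ?thesis by (simp add: essential_norm_def)
qed

lemma essential_norm_add:
  assumes f: "bounded_clinear f" and g: "bounded_clinear g"
  shows "essential_norm (\<lambda>x. f x + g x) \<le> essential_norm f + essential_norm g"
proof (rule field_le_epsilon)
  fix e :: real assume e: "e > 0"
  obtain F a where F: "finite_rank F" "0 \<le> a" "a < essential_norm f + e / 2" "\<And>x. norm (f x - F x) \<le> a * norm x"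
    using essential_norm_approx[OF f, of "essential_norm f + e / 2"] e by auto
  obtain G b where G: "finite_rank G" "0 \<le> b" "b < essential_norm g + e / 2" "\<And>x. norm (g x - G x) \<le> b * norm x"
    using essential_norm_approx[OF g, of "essential_norm g + e / 2"] e by auto
  have "essential_norm (\<lambda>x. f x + g x) \<le> a + b"
  proof (rule essential_norm_le[OF finite_rank_add[OF F(1) G(1)]])
    fix x
    have "f x + g x - (F x + G x) = (f x - F x) + (g x - G x)" by simp
    then show "norm (f x + g x - (F x + G x)) \<le> (a + b) * norm x"
      using norm_triangle_ineq[of "f x - F x" "g x - G x"] F(4)[of x] G(4)[of x]
      by (simp only: distrib_right)
  qed (use F G in simp)
  then show "essential_norm (\<lambda>x. f x + g x) \<le> essential_norm f + essential_norm g + e"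
    using F(3) G(3) by simp
qed

lemma essential_norm_compose:
  assumes f: "bounded_clinear f" and g: "bounded_clinear g"
  shows "essential_norm (\<lambda>x. f (g x)) \<le> essential_norm f * essential_norm g"
proof (rule tendsto_lowerbound)
  show "((\<lambda>e. (essential_norm f + e) * (essential_norm g + e)) \<longlongrightarrow> essential_norm f * essential_norm g) (at_right 0)"
    by (auto intro!: tendsto_eq_intros)
  have "essential_norm (\<lambda>x. f (g x)) \<le> (essential_norm f + e) * (essential_norm g + e)" if e: "e > 0" for e
  proof -
    obtain F a where F: "finite_rank F" "0 \<le> a" "a < essential_norm f + e" "\<And>x. norm (f x - F x) \<le> a * norm x"
      using essential_norm_approx[OF f, of "essential_norm f + e"] e by auto
    obtain G b where G: "finite_rank G" "0 \<le> b" "b < essential_norm g + e" "\<And>x. norm (g x - G x) \<le> b * norm x"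
      using essential_norm_approx[OF g, of "essential_norm g + e"] e by auto
    have bF: "bounded_clinear F" using F(1) by (simp add: finite_rank_def)
    \<comment> \<open>\<open>f g - (f - F) (g - G)\<close>, expanded so that each term visibly has finite rank.\<close>
    have fr: "finite_rank (\<lambda>x. F (g x) + (f (G x) - F (G x)))"
      by (intro finite_rank_add finite_rank_diff finite_rank_compose_right[OF F(1) g]
          finite_rank_compose_left[OF G(1) f] finite_rank_compose_left[OF G(1) bF])
    have "essential_norm (\<lambda>x. f (g x)) \<le> a * b"
    proof (rule essential_norm_le[OF fr])
      fix x
      have "f (g x) - (F (g x) + (f (G x) - F (G x))) = f (g x - G x) - F (g x - G x)"
        by (simp add: bounded_clinear_imp[OF f] bounded_clinear_imp[OF bF])
      also have "norm \<dots> \<le> a * norm (g x - G x)" by (rule F(4))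
      also have "\<dots> \<le> a * (b * norm x)" using G(4) F(2) by (rule mult_left_mono)
      finally show "norm (f (g x) - (F (g x) + (f (G x) - F (G x)))) \<le> a * b * norm x" by simp
    qed (use F G in simp)
    also have "\<dots> \<le> (essential_norm f + e) * (essential_norm g + e)"
      using F G by (intro mult_mono) auto
    finally show ?thesis .
  qed
  then show "\<forall>\<^sub>F e in at_right 0. essential_norm (\<lambda>x. f (g x)) \<le> (essential_norm f + e) * (essential_norm g + e)"
    by (auto intro: eventually_mono[OF eventually_at_right_less])
qed simp

lemma essential_norm_scale: "essential_norm (\<lambda>x. c *\<^sub>C x) \<le> cmod c"
  by (rule essential_norm_le[OF finite_rank_zero]) (simp_all add: norm_scaleC)

definition eq_mod_finite_rank :: "('a::complex_banach \<Rightarrow> 'a) \<Rightarrow> ('a \<Rightarrow> 'a) \<Rightarrow> bool" where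
  "eq_mod_finite_rank f g \<longleftrightarrow> bounded_clinear f \<and> bounded_clinear g \<and> finite_rank (\<lambda>x. f x - g x)"

text \<open>The quotient is by the ideal of finite-rank operators itself rather than by its closure or by the
compact operators: \<^const>\<open>essential_norm\<close> is then only a seminorm, but equality of classes says
exactly what the Fredholm and Weyl criteria need.\<close>
quotient_type (overloaded) 'a calkin = "'a::complex_banach \<Rightarrow> 'a" / partial: eq_mod_finite_rank
proof (rule part_equivpI)
  show "\<exists>f. eq_mod_finite_rank f (f :: 'a \<Rightarrow> 'a)"
    by (intro exI[of _ "\<lambda>x. x"]) (simp add: eq_mod_finite_rank_def bounded_clinear_intros finite_rank_zero)
  show "symp (eq_mod_finite_rank :: ('a \<Rightarrow> 'a) \<Rightarrow> _)"
    unfolding symp_def eq_mod_finite_rank_def by (metis (no_types, lifting) ext finite_rank_minus minus_diff_eq)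
  show "transp (eq_mod_finite_rank :: ('a \<Rightarrow> 'a) \<Rightarrow> _)"
  proof (rule transpI)
    fix f g h :: "'a \<Rightarrow> 'a"
    assume "eq_mod_finite_rank f g" "eq_mod_finite_rank g h"
    then show "eq_mod_finite_rank f h"
      using finite_rank_add[of "\<lambda>x. f x - g x" "\<lambda>x. g x - h x"] by (simp add: eq_mod_finite_rank_def)
  qed
qed

text \<open>The class \<open>ring_1\<close> would require \<open>0 \<noteq> 1\<close>, which fails on finite-dimensional spaces.\<close>
instantiation calkin :: (complex_banach) "{ring, monoid_mult}"
begin

lift_definition zero_calkin :: "'a calkin" is "\<lambda>x. 0"
  by (simp add: eq_mod_finite_rank_def bounded_clinear_intros finite_rank_zero)

lift_definition one_calkin :: "'a calkin" is "\<lambda>x. x"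
  by (simp add: eq_mod_finite_rank_def bounded_clinear_intros finite_rank_zero)

lift_definition plus_calkin :: "'a calkin \<Rightarrow> 'a calkin \<Rightarrow> 'a calkin" is "\<lambda>f g x. f x + g x"
  subgoal for f f' g g'
    using finite_rank_add[of "\<lambda>x. f x - f' x" "\<lambda>x. g x - g' x"]
    by (simp add: eq_mod_finite_rank_def bounded_clinear_intros add_diff_add)
  done

lift_definition uminus_calkin :: "'a calkin \<Rightarrow> 'a calkin" is "\<lambda>f x. - f x"
  subgoal for f f'
    using finite_rank_minus[of "\<lambda>x. f x - f' x"]
    by (simp add: eq_mod_finite_rank_def bounded_clinear_intros)
  done

lift_definition minus_calkin :: "'a calkin \<Rightarrow> 'a calkin \<Rightarrow> 'a calkin" is "\<lambda>f g x. f x - g x"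
  subgoal for f f' g g'
    using finite_rank_diff[of "\<lambda>x. f x - f' x" "\<lambda>x. g x - g' x"]
    by (simp add: eq_mod_finite_rank_def bounded_clinear_intros algebra_simps)
  done

lift_definition times_calkin :: "'a calkin \<Rightarrow> 'a calkin \<Rightarrow> 'a calkin" is "\<lambda>f g x. f (g x)"
  subgoal for f f' g g'
    using finite_rank_add[OF finite_rank_compose_right[of "\<lambda>x. f x - f' x" g]
        finite_rank_compose_left[of "\<lambda>x. g x - g' x" f']]
    by (simp add: eq_mod_finite_rank_def bounded_clinear_intros bounded_clinear_imp)
  done

instance
proof
  fix a b c :: "'a calkin"
  have refl: "eq_mod_finite_rank f f" if "bounded_clinear f" for f :: "'a \<Rightarrow> 'a"
    using that by (simp add: eq_mod_finite_rank_def finite_rank_zero)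
  note [simp] = eq_mod_finite_rank_def bounded_clinear_intros finite_rank_zero bounded_clinear_imp
  show "a + b + c = a + (b + c)" by transfer (simp add: algebra_simps)
  show "a + b = b + a" by transfer (simp add: algebra_simps)
  show "0 + a = a" by transfer simp
  show "- a + a = 0" by transfer simp
  show "a - b = a + - b" by transfer simp
  show "a * b * c = a * (b * c)"
    by transfer (auto simp: refl intro: bounded_clinear_intros(7))
  show "(a + b) * c = a * c + b * c" by transfer simp
  show "a * (b + c) = a * b + a * c" by transfer simp
  show "1 * a = a" "a * 1 = a" by (transfer; simp)+
qed

end

lift_definition calkin_scalar :: "complex \<Rightarrow> 'a::complex_banach calkin" is "\<lambda>c x. c *\<^sub>C x"
  by (simp add: eq_mod_finite_rank_def bounded_clinear_intros finite_rank_zero)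

lift_definition calkin_norm :: "'a::complex_banach calkin \<Rightarrow> real" is essential_norm
  by (simp add: eq_mod_finite_rank_def essential_norm_cong)

abbreviation calkin_class :: "('a::complex_banach \<Rightarrow> 'a) \<Rightarrow> 'a calkin" where
  "calkin_class \<equiv> abs_calkin"

lemma eq_mod_finite_rank_refl: "bounded_clinear f \<Longrightarrow> eq_mod_finite_rank f f"
  by (simp add: eq_mod_finite_rank_def finite_rank_zero)

lemma calkin_class_arith:
  assumes "bounded_clinear f" "bounded_clinear g"
  shows "calkin_class f + calkin_class g = calkin_class (\<lambda>x. f x + g x)"
    "calkin_class f - calkin_class g = calkin_class (\<lambda>x. f x - g x)"
    "calkin_class f * calkin_class g = calkin_class (\<lambda>x. f (g x))"
  using assms
  by (simp_all add: plus_calkin.abs_eq minus_calkin.abs_eq times_calkin.abs_eq eq_mod_finite_rank_refl)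

lemma calkin_class_eq_iff:
  assumes "bounded_clinear f" "bounded_clinear g"
  shows "calkin_class f = calkin_class g \<longleftrightarrow> finite_rank (\<lambda>x. f x - g x)"
  using assms Quotient_rel[OF Quotient_calkin, of f g]
  by (auto simp: eq_mod_finite_rank_refl) (auto simp: eq_mod_finite_rank_def)

lemma calkin_class_exhaust:
  obtains f where "bounded_clinear f" "(x :: 'a::complex_banach calkin) = calkin_class f"
  using Quotient_rep_reflp[OF Quotient_calkin, of x] Quotient_abs_rep[OF Quotient_calkin, of x] that
  by (metis eq_mod_finite_rank_def)

text \<open>Atkinson's theorem.\<close>
lemma fredholm_iff_invertible:
  assumes A: "bounded_clinear A"
  shows "fredholm A \<longleftrightarrow> invertible_elem (calkin_class A)"
proof
  assume "fredholm A"
  then obtain S where S: "bounded_clinear S" "finite_rank (\<lambda>x. S (A x) - x)" "finite_rank (\<lambda>x. A (S x) - x)"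
    using fredholm_imp_inverse_mod_finite_rank[OF A] by blast
  then have "calkin_class A * calkin_class S = 1" "calkin_class S * calkin_class A = 1"
    using A by (simp_all add: calkin_class_arith[OF A S(1)] calkin_class_arith(3)[OF S(1) A]
        one_calkin_def calkin_class_eq_iff bounded_clinear_intros)
  then show "invertible_elem (calkin_class A)" using invertible_elem_def by blast
next
  assume "invertible_elem (calkin_class A)"
  then obtain s where s: "calkin_class A * s = 1" "s * calkin_class A = 1" using invertible_elem_def by blast
  obtain S where S: "bounded_clinear S" "s = calkin_class S" using calkin_class_exhaust .
  have "finite_rank (\<lambda>x. S (A x) - x)" "finite_rank (\<lambda>x. A (S x) - x)"
    using s A S by (simp_all add: calkin_class_arith[OF A S(1)] calkin_class_arith(3)[OF S(1) A]
        one_calkin_def calkin_class_eq_iff bounded_clinear_intros)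
  then show "fredholm A"
    using fredholm_if_inverse_mod_finite_rank[OF A] bounded_clinear_imp(4)[OF S(1)] by blast
qed

definition weyl_classes :: "'a::complex_banach calkin set" where
  "weyl_classes = calkin_class ` {V. bounded_clinear V \<and> bij V}"

lemma weyl_iff_weyl_class:
  assumes A: "bounded_clinear A"
  shows "weyl A \<longleftrightarrow> calkin_class A \<in> weyl_classes"
proof
  assume "weyl A"
  then obtain V where V: "bounded_clinear V" "bij V" "finite_rank (\<lambda>x. V x - A x)"
    using weyl_imp_bijective_mod_finite_rank[OF A] by blast
  then have "calkin_class V = calkin_class A" using A by (simp add: calkin_class_eq_iff)
  moreover have "calkin_class V \<in> weyl_classes"
    unfolding weyl_classes_def using V(1,2) by (intro imageI) simp
  ultimately show "calkin_class A \<in> weyl_classes" by simp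
next
  assume "calkin_class A \<in> weyl_classes"
  then obtain V where V: "bounded_clinear V" "bij V" "calkin_class V = calkin_class A"
    unfolding weyl_classes_def by force
  then have "finite_rank (\<lambda>x. V x - A x)" using A by (simp add: calkin_class_eq_iff)
  then obtain B where "finite B" "\<And>x. V x - A x \<in> cspan B" using finite_rankE by blast
  then show "weyl A" using weyl_if_finite_rank_perturbation[OF A V(1,2)] by blast
qed

text \<open>The Weyl classes contain the unit ball around \<open>1\<close>: an operator at essential distance less than \<open>1\<close>
from the identity differs by finite rank from an operator \<open>1 - E\<close> with \<open>E\<close> a contraction.\<close>
interpretation calkin: open_unit_subgroup calkin_scalar calkin_norm "weyl_classes :: 'a::complex_banach calkin set"
proof
  note [simp] = eq_mod_finite_rank_def bounded_clinear_intros finite_rank_zero bounded_clinear_imp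
  fix a b :: complex and x y :: "'a calkin"
  show "calkin_scalar (a + b) = (calkin_scalar a + calkin_scalar b :: 'a calkin)"
    by transfer (simp add: scaleC_add_left)
  show "calkin_scalar (a * b) = (calkin_scalar a * calkin_scalar b :: 'a calkin)"
    by transfer (simp add: scaleC_scaleC)
  show "calkin_scalar 1 = (1 :: 'a calkin)" by transfer (simp add: scaleC_one)
  show "calkin_scalar a * x = x * calkin_scalar a" by transfer simp
  show "calkin_norm (x + y) \<le> calkin_norm x + calkin_norm y"
    by transfer (simp add: essential_norm_add)
  show "calkin_norm (x * y) \<le> calkin_norm x * calkin_norm y"
    by transfer (simp add: essential_norm_compose)
  show "calkin_norm (calkin_scalar a * x) \<le> cmod a * calkin_norm x"
  proof transfer
    fix a :: complex and f :: "'a \<Rightarrow> 'a" assume f: "eq_mod_finite_rank f f"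
    have "essential_norm (\<lambda>x. a *\<^sub>C f x) \<le> essential_norm (\<lambda>x::'a. a *\<^sub>C x) * essential_norm f"
      using f by (intro essential_norm_compose) auto
    also have "\<dots> \<le> cmod a * essential_norm f"
      using essential_norm_scale essential_norm_nonneg f by (intro mult_right_mono) auto
    finally show "essential_norm (\<lambda>x. a *\<^sub>C f x) \<le> cmod a * essential_norm f" .
  qed
  show "calkin_norm (1 :: 'a calkin) \<le> 1"
    by transfer (rule essential_norm_le[OF finite_rank_zero], simp_all)
  show "\<exists>y\<in>weyl_classes. x * y = 1 \<and> y * x = 1" if "x \<in> weyl_classes"
  proof -
    obtain V where V: "bounded_clinear V" "bij V" "x = calkin_class V"
      using \<open>x \<in> weyl_classes\<close> unfolding weyl_classes_def by blast
    have i: "bounded_clinear (inv V)" by (rule bounded_clinear_inv[OF V(1,2)])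
    have "V (inv V x) = x" "inv V (V x) = x" for x
      using V(2) by (simp_all add: bij_is_surj surj_f_inv_f bij_is_inj)
    then have "calkin_class V * calkin_class (inv V) = 1" "calkin_class (inv V) * calkin_class V = 1"
      by (simp_all only: calkin_class_arith(3)[OF V(1) i] calkin_class_arith(3)[OF i V(1)]
          one_calkin_def)
    moreover have "calkin_class (inv V) \<in> weyl_classes"
      using i V(2) bij_imp_bij_inv unfolding weyl_classes_def by blast
    ultimately show ?thesis using V(3) by blast
  qed
  show "x * y \<in> weyl_classes" if xy: "x \<in> weyl_classes" "y \<in> weyl_classes"
  proof -
    obtain V U where V: "bounded_clinear V" "bij V" "x = calkin_class V"
      and U: "bounded_clinear U" "bij U" "y = calkin_class U"
      using xy unfolding weyl_classes_def by blast
    have "bij (\<lambda>x. V (U x))" using bij_comp[OF U(2) V(2)] by (simp add: comp_def)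
    moreover have "bounded_clinear (\<lambda>x. V (U x))" using U(1) V(1) by simp
    ultimately show ?thesis
      unfolding weyl_classes_def V(3) U(3) calkin_class_arith(3)[OF V(1) U(1)] by blast
  qed
  show "x \<in> weyl_classes" if near: "calkin_norm (x - 1) < 1"
  proof -
    obtain f where f: "bounded_clinear f" "x = calkin_class f" using calkin_class_exhaust .
    have fi: "bounded_clinear (\<lambda>x. f x - x)" using f(1) by simp
    have "calkin_norm (x - 1) = essential_norm (\<lambda>x. f x - x)"
      using f fi unfolding one_calkin_def
      by (simp add: calkin_class_arith(2) calkin_norm.abs_eq eq_mod_finite_rank_refl)
    then obtain F a where F: "finite_rank F" "0 \<le> a" "a < 1" "\<And>x. norm (f x - x - F x) \<le> a * norm x"
      using essential_norm_approx[OF fi, of 1] near by auto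
    have bF: "bounded_clinear F" using F(1) by (simp add: finite_rank_def)
    define E where "E x = x - (f x - F x)" for x
    have "bounded_clinear E" unfolding E_def using f(1) bF by simp
    moreover have "norm (E x) \<le> a * norm x" for x
      using F(4)[of x] norm_minus_commute[of "f x - F x" x] by (simp add: E_def algebra_simps)
    ultimately have "bij (\<lambda>x. x - E x)" using F(3) contraction_bij[of E a] by blast
    moreover have "(\<lambda>x. x - E x) = (\<lambda>x. f x - F x)" by (simp add: E_def)
    moreover have b: "bounded_clinear (\<lambda>x. f x - F x)" using f(1) bF by simp
    moreover have "calkin_class (\<lambda>x. f x - F x) = x"
      using F(1) finite_rank_minus[OF F(1)] by (simp add: f calkin_class_eq_iff[OF b f(1)])
    ultimately show ?thesis unfolding weyl_classes_def by force
  qed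
qed

section \<open>Stability under commuting Riesz operators\<close>

text \<open>For \<open>z \<noteq> 0\<close>, \<open>1 - z R = - z (R - 1/z)\<close>.\<close>
lemma riesz_invertible:
  fixes R :: "'a::complex_banach \<Rightarrow> 'a"
  assumes R: "riesz R"
  shows "invertible_elem (1 - calkin_scalar z * calkin_class R)"
proof (cases "z = 0")
  case True
  then show ?thesis by (auto simp: calkin.sc_0 invertible_elem_def)
next
  case False
  have bR: "bounded_clinear R" using R by (simp add: riesz_def)
  have bz: "bounded_clinear (\<lambda>x. c *\<^sub>C x)" for c :: complex
    by (intro bounded_clinear_intros)
  have "fredholm (shift_op R (1 / z))" using R False by (simp add: riesz_def)
  then have "invertible_elem (calkin_class (shift_op R (1 / z)))"
    using fredholm_iff_invertible bounded_clinear_intros(4)[OF bR bz] by blast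
  also have "calkin_class (shift_op R (1 / z)) = calkin_class R - calkin_scalar (1 / z)"
    using calkin_class_arith(2)[OF bR bz] by (simp add: calkin_scalar_def)
  finally have "invertible_elem (calkin_class R - calkin_scalar (1 / z))" .
  moreover have "invertible_elem (calkin_scalar (- z) :: 'a calkin)"
    unfolding invertible_elem_def
    by (rule exI[of _ "calkin_scalar (- 1 / z)"]) (use False in \<open>simp add: calkin.sc_1 flip: calkin.sc_mult\<close>)
  ultimately have "invertible_elem (calkin_scalar (- z) * (calkin_class R - calkin_scalar (1 / z)))"
    by (rule invertible_elem_mult[rotated])
  moreover have "calkin_scalar (- z) * (calkin_class R - calkin_scalar (1 / z)) = 1 - calkin_scalar z * calkin_class R"
    using False unfolding right_diff_distrib calkin.sc_mult[symmetric]
    by (simp add: calkin.sc_minus calkin.sc_1)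
  ultimately show ?thesis by simp
qed

lemma commuting_riesz_perturbation:
  assumes T: "bounded_clinear T" and R: "riesz R" and comm: "\<And>x. T (R x) = R (T x)"
  shows "fredholm (\<lambda>x. T x + R x) \<longleftrightarrow> fredholm T" "weyl (\<lambda>x. T x + R x) \<longleftrightarrow> weyl T"
proof -
  have bR: "bounded_clinear R" using R by (simp add: riesz_def)
  have bTR: "bounded_clinear (\<lambda>x. T x + R x)" using T bR by (rule bounded_clinear_intros)
  let ?t = "calkin_class T" and ?r = "calkin_class R"
  have sum: "calkin_class (\<lambda>x. T x + R x) = ?t + ?r" using calkin_class_arith(1)[OF T bR] by simp
  have tr: "?t * ?r = ?r * ?t" using comm by (simp add: calkin_class_arith(3) T bR)
  show "fredholm (\<lambda>x. T x + R x) \<longleftrightarrow> fredholm T"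
    unfolding fredholm_iff_invertible[OF T] fredholm_iff_invertible[OF bTR] sum
    using calkin.quasinilpotent_perturbation_iff(1)[OF tr riesz_invertible[OF R]] .
  show "weyl (\<lambda>x. T x + R x) \<longleftrightarrow> weyl T"
    unfolding weyl_iff_weyl_class[OF T] weyl_iff_weyl_class[OF bTR] sum
    using calkin.quasinilpotent_perturbation_iff(2)[OF tr riesz_invertible[OF R]] .
qed

section \<open>Punctured neighbourhoods of pseudo B-Fredholm points\<close>

lemma small_calkin_perturbation:
  fixes A P :: "'a::complex_banach \<Rightarrow> 'a"
  assumes A: "bounded_clinear A" "fredholm A" and P: "bounded_clinear P"
  obtains e where "e > 0"
    "\<And>\<mu>. cmod \<mu> < e \<Longrightarrow> fredholm (\<lambda>x. A x - \<mu> *\<^sub>C P x)"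
    "\<And>\<mu>. cmod \<mu> < e \<Longrightarrow> weyl (\<lambda>x. A x - \<mu> *\<^sub>C P x) \<longleftrightarrow> weyl A"
proof -
  let ?a = "calkin_class A" and ?p = "calkin_class P"
  obtain v where v: "?a * v = 1" "v * ?a = 1"
    using A fredholm_iff_invertible invertible_elem_def by blast
  define e where "e = 1 / (1 + calkin_norm v * calkin_norm ?p)"
  have pos: "1 + calkin_norm v * calkin_norm ?p > 0"
    using calkin.p_nonneg[of v] calkin.p_nonneg[of ?p] by (simp add: add_pos_nonneg)
  have *: "fredholm (\<lambda>x. A x - \<mu> *\<^sub>C P x) \<and> (weyl (\<lambda>x. A x - \<mu> *\<^sub>C P x) \<longleftrightarrow> weyl A)"
    if \<mu>: "cmod \<mu> < e" for \<mu>
  proof -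
    have b: "bounded_clinear (\<lambda>x. A x - \<mu> *\<^sub>C P x)"
      by (rule bounded_clinear_intros(4)[OF A(1) bounded_clinear_intros(6)[OF P]])
    have bm: "bounded_clinear (\<lambda>x. (- \<mu>) *\<^sub>C x)"
      by (rule bounded_clinear_intros(6)[OF bounded_clinear_intros(1)])
    have bm': "bounded_clinear (\<lambda>x. (- \<mu>) *\<^sub>C P x)" by (rule bounded_clinear_intros(6)[OF P])
    have neg: "(*\<^sub>C) (- \<mu>) = (\<lambda>x :: 'a. - (\<mu> *\<^sub>C x))" by (simp add: fun_eq_iff)
    have eq: "calkin_class (\<lambda>x. A x - \<mu> *\<^sub>C P x) = ?a + calkin_scalar (- \<mu>) * ?p"
      using calkin_class_arith(3)[OF bm P] calkin_class_arith(1)[OF A(1) bm'] neg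
      by (simp add: calkin_scalar_def)
    have "calkin_norm v * calkin_norm (calkin_scalar (- \<mu>) * ?p) = cmod \<mu> * (calkin_norm v * calkin_norm ?p)"
      unfolding calkin.p_scale by simp
    also have "\<dots> \<le> cmod \<mu> * (1 + calkin_norm v * calkin_norm ?p)" by (simp add: mult_left_mono)
    also have "\<dots> < e * (1 + calkin_norm v * calkin_norm ?p)" using \<mu> pos by (rule mult_strict_right_mono)
    also have "\<dots> = 1" using pos by (simp add: e_def)
    finally have small: "calkin_norm v * calkin_norm (calkin_scalar (- \<mu>) * ?p) < 1" .
    show ?thesis
      unfolding fredholm_iff_invertible[OF b] weyl_iff_weyl_class[OF b] weyl_iff_weyl_class[OF A(1)] eq
      using calkin.small_perturbation[OF v small] by blast
  qed
  have "e > 0" using pos by (simp add: e_def)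
  then show ?thesis using * that by blast
qed

text \<open>Extending an operator on \<open>X1\<close> by the identity of \<open>X2\<close> changes neither the kernel nor the
complements of the range, so Fredholm theory on the closed subspace \<open>X1\<close> reduces to Fredholm
theory on the whole space.\<close>
lemma extend_by_bijection:
  assumes A: "bounded_clinear A" and P: "bounded_clinear P" "\<And>x. P x \<in> X1" "\<And>x. x - P x \<in> X2"
    "\<And>x. x \<in> X1 \<Longrightarrow> P x = x" "\<And>x. x \<in> X2 \<Longrightarrow> P x = 0"
    and ds: "direct_sum UNIV X1 X2" and inv: "A ` X1 \<subseteq> X1" and fr: "fredholm_on X1 A"
  defines "A1 \<equiv> (\<lambda>x. A (P x) + (x - P x))"
  shows "fredholm A1" "weyl A1 \<longleftrightarrow> weyl_on X1 A"
proof -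
  have s: "csubspace X1" "csubspace X2" and dis: "X1 \<inter> X2 = {0}" using ds by (auto simp: direct_sum_def)
  have comp: "a = 0 \<and> b = 0" if "a + b = 0" "a \<in> X1" "b \<in> X2" for a b
  proof -
    have "a = - b" using that(1) by (simp add: eq_neg_iff_add_eq_0)
    then have "a \<in> X1 \<inter> X2" using complex_vector.subspace_neg[OF s(2) that(3)] that(2) by simp
    then have "a = 0" unfolding dis by simp
    then show ?thesis using that(1) by simp
  qed
  have AP: "A (P x) \<in> X1" for x using inv P(2) by blast
  have ker: "ker_on UNIV A1 = ker_on X1 A"
  proof -
    have "A1 x = 0 \<longleftrightarrow> x \<in> X1 \<and> A x = 0" for x
    proof
      assume "A1 x = 0"
      then have "A (P x) = 0" "x - P x = 0" using comp[OF _ AP P(3)] by (auto simp: A1_def)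
      then show "x \<in> X1 \<and> A x = 0" using P(2)[of x] by simp
    qed (simp add: A1_def P(4))
    then show ?thesis by (auto simp: ker_on_def)
  qed
  have bA1: "bounded_clinear A1" unfolding A1_def
    by (rule bounded_clinear_intros(3)[OF bounded_clinear_intros(7)[OF A P(1)]
          bounded_clinear_intros(4)[OF bounded_clinear_intros(1) P(1)]])
  have ds1: "direct_sum UNIV (range A1) C" if C: "direct_sum X1 (A ` X1) C" for C
  proof -
    have sC: "csubspace C" and disC: "A ` X1 \<inter> C = {0}" and X1: "X1 = {w + c |w c. w \<in> A ` X1 \<and> c \<in> C}"
      using C by (auto simp: direct_sum_def)
    have "0 \<in> A ` X1" using disC by blast
    then have CX: "c \<in> X1" if "c \<in> C" for c using X1 that by force
    have "y = 0" if y: "y \<in> range A1" "y \<in> C" for y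
    proof -
      obtain x where x: "y = A (P x) + (x - P x)" using y(1) by (auto simp: A1_def)
      have "(A (P x) - y) + (x - P x) = 0" using x by simp
      moreover have "A (P x) - y \<in> X1" using complex_vector.subspace_diff[OF s(1) AP CX[OF y(2)]] .
      ultimately have "A (P x) - y = 0" using comp[OF _ _ P(3)[of x]] by blast
      then have "y = A (P x)" by simp
      then have "y \<in> A ` X1" using P(2)[of x] by (rule image_eqI)
      then have "y \<in> A ` X1 \<inter> C" using y(2) by simp
      then show ?thesis unfolding disC by simp
    qed
    moreover have "0 \<in> range A1" using bounded_clinear_imp(4)[OF bA1] by (metis rangeI)
    ultimately have i: "range A1 \<inter> C = {0}" using complex_vector.subspace_0[OF sC] by blast
    have "y \<in> {w + c |w c. w \<in> range A1 \<and> c \<in> C}" for y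
    proof -
      obtain x c where xc: "P y = A x + c" "x \<in> X1" "c \<in> C" using X1 P(2)[of y] by blast
      have Px: "P (x + (y - P y)) = x" using P(4)[OF xc(2)] P(5)[OF P(3)] by (simp add: bounded_clinear_imp(2)[OF P(1)])
      have "y = A1 (x + (y - P y)) + c" unfolding A1_def Px using xc(1) by simp
      then show ?thesis using xc(3) by blast
    qed
    then show ?thesis unfolding direct_sum_def
      using csubspace_image[OF bA1 complex_vector.subspace_UNIV] sC i by blast
  qed
  obtain C where C: "direct_sum X1 (A ` X1) C" "finite_cdim C"
    using fr by (auto simp: fredholm_on_def finite_ccodim_def)
  have fc: "finite_ccodim UNIV (range A1)" using ds1[OF C(1)] C(2) by (auto simp: finite_ccodim_def)
  show f1: "fredholm A1" using fr fc by (simp add: fredholm_on_def ker)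
  have "ccodim UNIV (range A1) = ccodim X1 (A ` X1)"
    using ccodim_eq[OF C] ccodim_eq[OF ds1[OF C(1)] C(2)] by simp
  then show "weyl A1 \<longleftrightarrow> weyl_on X1 A"
    using f1 fr by (simp add: weyl_on_def fredholm_index_on_def ker)
qed

text \<open>Let \<open>A1\<close> agree with \<open>A\<close> on \<open>X1\<close> and be the identity on \<open>X2\<close>.  For \<open>\<mu> \<noteq> 0\<close>, the operators \<open>A - \<mu>\<close>
and \<open>A1 - \<mu> P\<close> agree on \<open>X1\<close> and both map \<open>X2\<close> bijectively onto itself, so they have the same
kernel and the same range.  The second one is a small perturbation of the Fredholm operator \<open>A1\<close>.\<close>
lemma punctured_neighbourhood:
  assumes A: "bounded_clinear A"
    and X: "closed_invariant A X1" "closed_invariant A X2" "direct_sum UNIV X1 X2"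
    and fr: "fredholm_on X1 A" and qn: "quasinilpotent_on X2 A"
  obtains e where "e > 0"
    "\<And>\<mu>. \<mu> \<noteq> 0 \<Longrightarrow> cmod \<mu> < e \<Longrightarrow> fredholm (shift_op A \<mu>)"
    "\<And>\<mu>. \<mu> \<noteq> 0 \<Longrightarrow> cmod \<mu> < e \<Longrightarrow> weyl_on X1 A \<Longrightarrow> weyl (shift_op A \<mu>)"
proof -
  have cl: "closed X1" "closed X2" and inv: "A ` X1 \<subseteq> X1" "A ` X2 \<subseteq> X2"
    and s: "csubspace X1" "csubspace X2"
    using X by (auto simp: closed_invariant_def)
  obtain P where P: "bounded_clinear P" "\<And>x. P x \<in> X1" "\<And>x. x - P x \<in> X2"
    "\<And>x. x \<in> X1 \<Longrightarrow> P x = x" "\<And>x. x \<in> X2 \<Longrightarrow> P x = 0"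
    using direct_sum_projection[OF X(3) cl] by blast
  define A1 where "A1 = (\<lambda>x. A (P x) + (x - P x))"
  note A1 = extend_by_bijection[OF A P X(3) inv(1) fr, folded A1_def]
  have bA1: "bounded_clinear A1" unfolding A1_def
    by (rule bounded_clinear_intros(3)[OF bounded_clinear_intros(7)[OF A P(1)]
          bounded_clinear_intros(4)[OF bounded_clinear_intros(1) P(1)]])
  obtain e where e: "e > 0"
    "\<And>\<mu>. cmod \<mu> < e \<Longrightarrow> fredholm (\<lambda>x. A1 x - \<mu> *\<^sub>C P x)"
    "\<And>\<mu>. cmod \<mu> < e \<Longrightarrow> weyl (\<lambda>x. A1 x - \<mu> *\<^sub>C P x) \<longleftrightarrow> weyl A1"
    using small_calkin_perturbation[OF bA1 A1(1) P(1)] by blast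
  have same: "ker_on UNIV (shift_op A \<mu>) = ker_on UNIV (\<lambda>x. A1 x - \<mu> *\<^sub>C P x) \<and>
      range (shift_op A \<mu>) = range (\<lambda>x. A1 x - \<mu> *\<^sub>C P x)" if \<mu>: "\<mu> \<noteq> 0" for \<mu>
  proof -
    define B where "B = shift_op A \<mu>"
    have bB: "bounded_clinear B" unfolding B_def
      by (rule bounded_clinear_intros(4)[OF A bounded_clinear_intros(6)[OF bounded_clinear_intros(1)]])
    have "invertible_on X2 B"
      using qn \<mu> by (auto simp: quasinilpotent_on_def spectrum_on_def B_def)
    then obtain S where S: "\<And>x. x \<in> X2 \<Longrightarrow> S x \<in> X2" "\<And>x. x \<in> X2 \<Longrightarrow> S (B x) = x" "\<And>x. x \<in> X2 \<Longrightarrow> B (S x) = x"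
      unfolding invertible_on_def by blast
    have BX1: "B x \<in> X1" if "x \<in> X1" for x
      using that inv(1) s(1) by (auto simp: B_def intro!: complex_vector.subspace_diff complex_vector.subspace_scale)
    have BX2: "B x \<in> X2" if "x \<in> X2" for x
      using that inv(2) s(2) by (auto simp: B_def intro!: complex_vector.subspace_diff complex_vector.subspace_scale)
    have Px: "P (u + w) = u" if "u \<in> X1" "w \<in> X2" for u w
      using P(4)[OF that(1)] P(5)[OF that(2)] by (simp add: bounded_clinear_imp(2)[OF P(1)])
    define D where "D x = A1 x - \<mu> *\<^sub>C P x" for x
    have D: "D x = B (P x) + (x - P x)" for x by (simp add: D_def B_def A1_def)
    have Bx: "B x = B (P x) + B (x - P x)" for x using bounded_clinear_imp(2)[OF bB, of "P x" "x - P x"] by simp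
    have BD: "B x = D (P x + B (x - P x))" for x
      unfolding D Px[OF P(2) BX2[OF P(3)]] using Bx[of x] by simp
    have DB: "D x = B (P x + S (x - P x))" for x
      unfolding Bx[of "P x + S (x - P x)"] Px[OF P(2) S(1)[OF P(3)]] using S(3)[OF P(3)] by (simp add: D)
    have "B x = 0 \<longleftrightarrow> D x = 0" for x
    proof
      assume "B x = 0"
      then have "P (B (P x) + B (x - P x)) = 0" using Bx[of x] bounded_clinear_imp(4)[OF P(1)] by simp
      then have 1: "B (P x) = 0" using Px[OF BX1[OF P(2)] BX2[OF P(3)]] by simp
      then have "B (x - P x) = 0" using Bx[of x] \<open>B x = 0\<close> by simp
      then have "x - P x = S 0" using S(2)[OF P(3)[of x]] by simp
      moreover have "S 0 = 0" using S(2)[of 0] bounded_clinear_imp(4)[OF bB] complex_vector.subspace_0[OF s(2)] by simp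
      ultimately show "D x = 0" using 1 by (simp add: D)
    next
      assume "D x = 0"
      then have "P (B (P x) + (x - P x)) = 0" using D[of x] bounded_clinear_imp(4)[OF P(1)] by simp
      then have 1: "B (P x) = 0" using Px[OF BX1[OF P(2)] P(3)] by simp
      then have "x - P x = 0" using D[of x] \<open>D x = 0\<close> by simp
      then show "B x = 0" using 1 by simp
    qed
    moreover have "range B = range D" using BD DB by (metis (no_types, lifting) image_subsetI rangeI subset_antisym)
    ultimately show ?thesis unfolding B_def[symmetric] D_def[symmetric] by (simp add: ker_on_def)
  qed
  show ?thesis
  proof (rule that[OF e(1)])
    fix \<mu> :: complex assume \<mu>: "\<mu> \<noteq> 0" "cmod \<mu> < e"
    show "fredholm (shift_op A \<mu>)"
      using e(2)[OF \<mu>(2)] same[OF \<mu>(1)] by (simp add: fredholm_on_def)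
    show "weyl (shift_op A \<mu>)" if "weyl_on X1 A"
      using e(3)[OF \<mu>(2)] A1(2) that same[OF \<mu>(1)]
      by (simp add: weyl_on_def fredholm_on_def fredholm_index_on_def)
  qed
qed

section \<open>The perturbation theorem\<close>

lemma trivial_decomposition:
  assumes "bounded_clinear A"
  shows "closed_invariant A UNIV" "closed_invariant A {0}" "direct_sum UNIV UNIV {0}" "quasinilpotent_on {0} A"
proof -
  show "closed_invariant A UNIV" "closed_invariant A {0}"
    by (simp_all add: closed_invariant_def complex_vector.subspace_UNIV complex_vector.subspace_single_0
        bounded_clinear_imp(4)[OF assms])
  show "direct_sum UNIV UNIV {0}"
    by (simp add: direct_sum_def complex_vector.subspace_UNIV complex_vector.subspace_single_0)
  have "invertible_on {0} (shift_op A \<mu>)" for \<mu>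
    unfolding invertible_on_def
    by (rule exI[of _ "\<lambda>x. x"]) (simp add: bounded_clinear_imp(4)[OF assms])
  then show "quasinilpotent_on {0} A" by (simp add: quasinilpotent_on_def spectrum_on_def)
qed

lemma isolated_point_if_punctured:
  assumes "\<nu> \<in> \<Sigma>" "e > 0" "\<And>\<mu>. \<mu> \<noteq> 0 \<Longrightarrow> cmod \<mu> < e \<Longrightarrow> \<nu> + \<mu> \<notin> \<Sigma>"
  shows "\<nu> \<in> isolated_points_of \<Sigma>"
proof -
  have "z \<notin> \<Sigma>" if "z \<noteq> \<nu>" "dist z \<nu> < e" for z
    using assms(3)[of "z - \<nu>"] that by (simp add: dist_norm)
  then show ?thesis using assms(1,2) by (auto simp: isolated_points_of_def eventually_at)
qed

text \<open>A point of the essential spectrum that is not in the pseudo B-Fredholm spectrum is isolated in the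
former, by the punctured neighbourhood; the other inclusion comes from the decomposition with
second summand \<open>{0}\<close>.\<close>
lemma pseudo_b_spectra_without_isolated_points:
  assumes T: "bounded_clinear T"
  shows "isolated_points_of (essential_spectrum T) = {} \<Longrightarrow> pseudo_b_fredholm_spectrum T = essential_spectrum T"
    and "isolated_points_of (weyl_spectrum T) = {} \<Longrightarrow> pseudo_b_weyl_spectrum T = weyl_spectrum T"
proof -
  have b: "bounded_clinear (shift_op T \<nu>)" for \<nu>
    by (rule bounded_clinear_intros(4)[OF T bounded_clinear_intros(6)[OF bounded_clinear_intros(1)]])
  have shift: "shift_op (shift_op T \<nu>) \<mu> = shift_op T (\<nu> + \<mu>)" for \<nu> \<mu>
    by (simp add: scaleC_add_left fun_eq_iff)
  note triv = trivial_decomposition[OF b]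
  show "pseudo_b_fredholm_spectrum T = essential_spectrum T"
    if iso: "isolated_points_of (essential_spectrum T) = {}"
  proof -
    have "pseudo_b_fredholm (shift_op T \<nu>) \<longleftrightarrow> fredholm (shift_op T \<nu>)" for \<nu>
    proof
      assume "pseudo_b_fredholm (shift_op T \<nu>)"
      then obtain X1 X2 where X: "closed_invariant (shift_op T \<nu>) X1" "closed_invariant (shift_op T \<nu>) X2"
        "direct_sum UNIV X1 X2" "fredholm_on X1 (shift_op T \<nu>)" "quasinilpotent_on X2 (shift_op T \<nu>)"
        unfolding pseudo_b_fredholm_def by blast
      obtain e where "e > 0" "\<And>\<mu>. \<mu> \<noteq> 0 \<Longrightarrow> cmod \<mu> < e \<Longrightarrow> fredholm (shift_op T (\<nu> + \<mu>))"
        using punctured_neighbourhood[OF b X] unfolding shift by metis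
      then have "\<nu> \<notin> essential_spectrum T"
        using iso isolated_point_if_punctured[of \<nu> "essential_spectrum T" e]
        by (auto simp: essential_spectrum_def)
      then show "fredholm (shift_op T \<nu>)" by (simp add: essential_spectrum_def)
    next
      assume "fredholm (shift_op T \<nu>)"
      then show "pseudo_b_fredholm (shift_op T \<nu>)" unfolding pseudo_b_fredholm_def using triv by blast
    qed
    then show ?thesis by (simp add: pseudo_b_fredholm_spectrum_def essential_spectrum_def)
  qed
  show "pseudo_b_weyl_spectrum T = weyl_spectrum T"
    if iso: "isolated_points_of (weyl_spectrum T) = {}"
  proof -
    have "pseudo_b_weyl (shift_op T \<nu>) \<longleftrightarrow> weyl (shift_op T \<nu>)" for \<nu>
    proof
      assume "pseudo_b_weyl (shift_op T \<nu>)"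
      then obtain X1 X2 where X: "closed_invariant (shift_op T \<nu>) X1" "closed_invariant (shift_op T \<nu>) X2"
        "direct_sum UNIV X1 X2" and w: "weyl_on X1 (shift_op T \<nu>)" and q: "quasinilpotent_on X2 (shift_op T \<nu>)"
        unfolding pseudo_b_weyl_def by blast
      have fr: "fredholm_on X1 (shift_op T \<nu>)" using w by (simp add: weyl_on_def)
      obtain e where "e > 0" "\<And>\<mu>. \<mu> \<noteq> 0 \<Longrightarrow> cmod \<mu> < e \<Longrightarrow> weyl (shift_op T (\<nu> + \<mu>))"
        using punctured_neighbourhood[OF b X fr q] w unfolding shift by metis
      then have "\<nu> \<notin> weyl_spectrum T"
        using iso isolated_point_if_punctured[of \<nu> "weyl_spectrum T" e]
        by (auto simp: weyl_spectrum_def)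
      then show "weyl (shift_op T \<nu>)" by (simp add: weyl_spectrum_def)
    next
      assume "weyl (shift_op T \<nu>)"
      then show "pseudo_b_weyl (shift_op T \<nu>)" unfolding pseudo_b_weyl_def using triv by blast
    qed
    then show ?thesis by (simp add: pseudo_b_weyl_spectrum_def weyl_spectrum_def)
  qed
qed

theorem theorem3p1:
  fixes T R :: "'a::complex_banach \<Rightarrow> 'a"
  assumes "bounded_clinear T"
    and "bounded_clinear R"
    and "riesz R"
    and "T \<circ> R = R \<circ> T"
  shows "(isolated_points_of (essential_spectrum T) = {} \<longrightarrow>
            pseudo_b_fredholm_spectrum (\<lambda>x. T x + R x) = pseudo_b_fredholm_spectrum T) \<and>
         (isolated_points_of (weyl_spectrum T) = {} \<longrightarrow>
            pseudo_b_weyl_spectrum (\<lambda>x. T x + R x) = pseudo_b_weyl_spectrum T)"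
proof -
  have TR: "bounded_clinear (\<lambda>x. T x + R x)" using assms(1,2) by (rule bounded_clinear_intros)
  have shift: "shift_op (\<lambda>x. T x + R x) \<mu> = (\<lambda>x. shift_op T \<mu> x + R x)" for \<mu>
    by (simp add: fun_eq_iff)
  have b: "bounded_clinear (shift_op T \<mu>)" for \<mu>
    by (rule bounded_clinear_intros(4)[OF assms(1) bounded_clinear_intros(6)[OF bounded_clinear_intros(1)]])
  have comm: "shift_op T \<mu> (R x) = R (shift_op T \<mu> x)" for \<mu> x
    using fun_cong[OF assms(4), of x] by (simp add: bounded_clinear_imp[OF assms(2)])
  have pert: "fredholm (\<lambda>x. shift_op T \<mu> x + R x) \<longleftrightarrow> fredholm (shift_op T \<mu>)"
      "weyl (\<lambda>x. shift_op T \<mu> x + R x) \<longleftrightarrow> weyl (shift_op T \<mu>)" for \<mu>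
    using commuting_riesz_perturbation[of "shift_op T \<mu>" R] b[of \<mu>] assms(3) comm by simp_all
  have "essential_spectrum (\<lambda>x. T x + R x) = essential_spectrum T"
    unfolding essential_spectrum_def shift pert(1) ..
  moreover have "weyl_spectrum (\<lambda>x. T x + R x) = weyl_spectrum T"
    unfolding weyl_spectrum_def shift pert(2) ..
  ultimately show ?thesis
    using pseudo_b_spectra_without_isolated_points[OF TR] pseudo_b_spectra_without_isolated_points[OF assms(1)]
    by simp
qed

end
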